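(* Let $m\geq0$, $r\geq2$ and $0\leq i\leq r$ be integers. Then \[ \sum_{s_1\geq\dots\geq s_{r}\geq-\lfloor m/2\rfloor}\frac{q^{s_1^2+\dots+s_{r}^2+m(s_1+\dots+s_{r-1})-s_1-\dots-s_{i}}(-q)_{m+2s_r-1}}{(q)_{s_1-s_2}\cdots(q)_{s_{r-2}-s_{r-1}}(q^2;q^2)_{s_{r-1}-s_{r}}}(-1)^{s_r}\begin{bmatrix}m+s_r\\ m+2s_r\end{bmatrix}_{q^2}=a_m, \] where (the sum on the left running over integers $s_1,\dots,s_r$, and $s_1+\dots+s_i=0$ when $i=0$) for every integer $p\ge0$, \[ a_{2p}=\sum_{k=0}^{i}\sum_{\ell=0}^{2p}(-1)^\ell q^{2pk+2p\ell}\frac{(q^{2r},q^{2p(r-1)+r-i+2k+2\ell},q^{r+i-2p(r-1)-2k-2\ell};q^{2r})_\infty}{2(q)_\infty}, \] \[ a_{2p+1}=(-1)^pq^{(2-r)p^2+(1+i-r)p}\sum_{\ell=0}^{p}q^{2\ell}\frac{(q^{2r},q^{2r-2p-1-i+4\ell},q^{i+2p+1-4\ell};q^{2r})_\infty}{(q)_\infty}. \]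
   Context: $q$ is a complex number with $|q|<1$. For complex $x$ and base $p'$ with $|p'|<1$, $(x;p')_\infty=\prod_{j\ge0}(1-xp'^j)$, $(x;p')_k=(x;p')_\infty/(xp'^k;p')_\infty$ for $k\in\mathbb{Z}$ (e.g. $(-q)_{-1}=1/2$), $(x)_k=(x;q)_k$, and $(x_1,\dots,x_m;p')_\infty=\prod_i(x_i;p')_\infty$. For integers $N\ge0$ and $j$, $\begin{bmatrix}N\\ j\end{bmatrix}_{q^2}=\frac{(q^2;q^2)_N}{(q^2;q^2)_j(q^2;q^2)_{N-j}}$ if $0\le j\le N$ and $0$ otherwise.
   Formalization: The range is 0≤i≤r−1 instead of 0≤i≤r, since the identity fails at i=r (for m=0, r=i=2 the left side tends to 1 and the right to 1/2 as q→0); also q≠0 is assumed, since negative powers of q occur. *)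

theory Defs
  imports "HOL-Analysis.Analysis"
begin

definition qpoch_inf :: "complex \<Rightarrow> complex \<Rightarrow> complex" where
  "qpoch_inf x p = prodinf (\<lambda>j. 1 - x * p ^ j)"

definition qpoch_infs :: "complex list \<Rightarrow> complex \<Rightarrow> complex" where
  "qpoch_infs xs p = (\<Prod>x\<leftarrow>xs. qpoch_inf x p)"

text \<open>The finite symbol has an integer index; for \<open>k < 0\<close> the definition is meaningful only
  for \<open>p \<noteq> 0\<close>, since \<open>0 powi k = 0\<close> by convention.\<close>

definition qpoch :: "complex \<Rightarrow> complex \<Rightarrow> int \<Rightarrow> complex" where
  "qpoch x p k = qpoch_inf x p / qpoch_inf (x * p powi k) p"

definition qbinom :: "complex \<Rightarrow> int \<Rightarrow> int \<Rightarrow> complex" where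
  "qbinom p N j =
     (if 0 \<le> j \<and> j \<le> N then qpoch p p N / (qpoch p p j * qpoch p p (N - j)) else 0)"

definition a_even :: "complex \<Rightarrow> nat \<Rightarrow> nat \<Rightarrow> nat \<Rightarrow> complex" where
  "a_even q r i p =
     (\<Sum>k=0..i. \<Sum>l=0..2*p. (-1) ^ l * q ^ (2*p*k + 2*p*l) *
        (qpoch_infs
           [q ^ (2*r),
            q powi (2 * int p * (int r - 1) + int r - int i + 2 * int k + 2 * int l),
            q powi (int r + int i - 2 * int p * (int r - 1) - 2 * int k - 2 * int l)]
           (q ^ (2*r))
         / (2 * qpoch_inf q q)))"

definition a_odd :: "complex \<Rightarrow> nat \<Rightarrow> nat \<Rightarrow> nat \<Rightarrow> complex" where
  "a_odd q r i p =
     (-1) ^ p * q powi ((2 - int r) * (int p)\<^sup>2 + (1 + int i - int r) * int p) *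
     (\<Sum>l=0..p. q ^ (2*l) *
        (qpoch_infs
           [q ^ (2*r),
            q powi (2 * int r - 2 * int p - 1 - int i + 4 * int l),
            q powi (int i + 2 * int p + 1 - 4 * int l)]
           (q ^ (2*r))
         / qpoch_inf q q))"

definition a_seq :: "complex \<Rightarrow> nat \<Rightarrow> nat \<Rightarrow> nat \<Rightarrow> complex" where
  "a_seq q r i m = (if even m then a_even q r i (m div 2) else a_odd q r i (m div 2))"

text \<open>The tuples \<open>(s\<^sub>1, \<dots>, s\<^sub>r)\<close> are extensional functions on \<open>{1..r}\<close>, so that each tuple is
  represented exactly once.\<close>

definition index_tuples :: "nat \<Rightarrow> nat \<Rightarrow> (nat \<Rightarrow> int) set" where
  "index_tuples m r =
     {s \<in> {1..r} \<rightarrow>\<^sub>E UNIV. (\<forall>j\<in>{1..<r}. s j \<ge> s (Suc j)) \<and> s r \<ge> - \<lfloor>real m / 2\<rfloor>}"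

end

theory Submission
  imports Defs
begin

text \<open>
  Put \<open>K\<^sub>n\<^sub>,\<^sub>j = 1 / ((q)\<^sub>n\<^sub>-\<^sub>j (q)\<^sub>n\<^sub>+\<^sub>j\<^sub>+\<^sub>m)\<close>. Sequences related by \<open>\<beta>\<^sub>n = \<Sum>\<^sub>j \<alpha>\<^sub>j K\<^sub>n\<^sub>,\<^sub>j\<close>, with \<open>j\<close> running over
  all integers, form a bilateral Bailey pair. The q-binomial theorem evaluates the factor
  \<open>(-1)\<^sup>s q\<^sup>s\<^sup>(\<^sup>s\<^sup>-\<^sup>1\<^sup>)\<close> times the q-binomial coefficient as the \<open>\<beta>\<close>-side of a pair in base \<open>q\<^sup>2\<close>; a quadratic
  change of base turns the sum over \<open>s\<^sub>r\<close> into the \<open>\<beta>\<close>-side of a pair in base \<open>q\<close> with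
  \<open>\<alpha>\<^sub>j = (-1)\<^sup>j q\<^sup>j\<^sup>2 / (1 + q\<^sup>2\<^sup>j\<^sup>+\<^sup>m)\<close>. Each sum over \<open>s\<^sub>r\<^sub>-\<^sub>1, \<dots>, s\<^sub>1\<close> is then one step of the Bailey chain,
  where the linear terms \<open>-s\<^sub>1 - \<dots> - s\<^sub>i\<close> call for the Bailey lattice. Letting the upper bound of \<open>s\<^sub>1\<close>
  tend to infinity leaves a bilateral sum over \<open>j\<close>; averaging it with its reflection \<open>j \<mapsto> -m - j\<close>
  cancels the denominator \<open>1 + q\<^sup>2\<^sup>j\<^sup>+\<^sup>m\<close>, and the Jacobi triple product gives the infinite products.
\<close>

section \<open>Finite q-series\<close>

definition qpoch_fin :: "'a::comm_ring_1 \<Rightarrow> 'a \<Rightarrow> nat \<Rightarrow> 'a" where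
  "qpoch_fin x q n = (\<Prod>i<n. 1 - x * q ^ i)"

lemma qpoch_fin_0 [simp]: "qpoch_fin x q 0 = 1"
  and qpoch_fin_Suc: "qpoch_fin x q (Suc n) = qpoch_fin x q n * (1 - x * q ^ n)"
  by (simp_all add: qpoch_fin_def)

lemma qpoch_fin_add: "qpoch_fin x q (m + n) = qpoch_fin x q m * qpoch_fin (x * q ^ m) q n"
  by (induction n) (simp_all add: qpoch_fin_Suc power_add mult_ac)

lemma qpoch_fin_eq_0: "x * q ^ i = 1 \<Longrightarrow> i < n \<Longrightarrow> qpoch_fin x q n = 0"
  unfolding qpoch_fin_def by (rule prod_zero) auto

definition not_root_of_unity :: "'a::monoid_mult \<Rightarrow> bool" where
  "not_root_of_unity q \<longleftrightarrow> (\<forall>n>0. q ^ n \<noteq> 1)"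

lemma not_root_of_unity_power: "not_root_of_unity q \<Longrightarrow> k > 0 \<Longrightarrow> not_root_of_unity (q ^ k)"
  by (simp add: not_root_of_unity_def flip: power_mult)

lemma not_root_of_unity_if_norm_less_1:
  fixes q :: "'a::real_normed_div_algebra"
  assumes "norm q < 1"
  shows "not_root_of_unity q"
proof -
  have "norm q ^ n < 1" if "n > 0" for n
    using assms that by (simp add: power_less_one_iff)
  then show ?thesis
    by (metis norm_one norm_power not_root_of_unity_def less_irrefl)
qed

lemma power_int_eq_1_iff:
  fixes q :: "'a::field"
  assumes "not_root_of_unity q"
  shows "q powi k = 1 \<longleftrightarrow> k = 0"
  using assms by (cases k rule: int_cases4) (auto simp: not_root_of_unity_def power_int_minus)

text \<open>Like \<open>rGamma\<close>, this reciprocal is total: it vanishes at the negative integers, as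
  \<open>(q)\<^sub>k = (q)\<^sub>\<infinity> / (q\<^sup>k\<^sup>+\<^sup>1)\<^sub>\<infinity>\<close> prescribes, so that the recurrence below holds without exception.\<close>

definition rqfac :: "'a::field \<Rightarrow> int \<Rightarrow> 'a" where
  "rqfac q k = (if k < 0 then 0 else 1 / qpoch_fin q q (nat k))"

lemma rqfac_neg [simp]: "k < 0 \<Longrightarrow> rqfac q k = 0"
  and rqfac_0 [simp]: "rqfac q 0 = 1"
  and rqfac_of_nat: "rqfac q (int n) = 1 / qpoch_fin q q n"
  by (simp_all add: rqfac_def)

lemma qpoch_fin_self_nonzero:
  fixes q :: "'a::field"
  assumes "not_root_of_unity q"
  shows "qpoch_fin q q n \<noteq> 0"
  using assms by (auto simp: qpoch_fin_def not_root_of_unity_def simp flip: power_Suc)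

lemma rqfac_pred:
  assumes "not_root_of_unity q"
  shows "rqfac q (k - 1) = (1 - q powi k) * rqfac q k"
proof (cases "k > 0")
  case True
  then obtain n where n: "k = int (Suc n)"
    by (metis pos_int_cases gr0_implies_Suc)
  have "1 - q powi k \<noteq> 0"
    using power_int_eq_1_iff[OF assms, of k] True by auto
  moreover have "q powi k = q * q ^ n"
    unfolding n power_int_of_nat by simp
  moreover have "k - 1 = int n"
    by (simp add: n)
  ultimately show ?thesis
    using n by (simp only: rqfac_of_nat qpoch_fin_Suc) simp
qed (cases "k = 0"; simp)

lemma rqfac_pascal:
  assumes "q \<noteq> 0" "not_root_of_unity q"
  shows "(1 - q powi (a + b)) * (rqfac q a * rqfac q b) =
    rqfac q (a - 1) * rqfac q b + q powi a * (rqfac q a * rqfac q (b - 1))"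
  using assms by (simp add: rqfac_pred power_int_add algebra_simps)

lemma sum_rqfac_pascal:
  assumes "q \<noteq> 0" "not_root_of_unity q"
  shows "(1 - q powi M) * (\<Sum>t=0..M. f t * (rqfac q (M - t) * rqfac q t)) =
    (\<Sum>t=0..M-1. (f t + q powi (M - 1 - t) * f (t + 1)) * (rqfac q (M - 1 - t) * rqfac q t))"
proof -
  have "(1 - q powi M) * (\<Sum>t=0..M. f t * (rqfac q (M - t) * rqfac q t)) =
      (\<Sum>t=0..M. f t * ((1 - q powi (M - t + t)) * (rqfac q (M - t) * rqfac q t)))"
    by (simp add: sum_distrib_left mult_ac)
  also have "\<dots> = (\<Sum>t=0..M. f t * (rqfac q (M - t - 1) * rqfac q t)) +
      (\<Sum>t=0..M. f t * (q powi (M - t) * (rqfac q (M - t) * rqfac q (t - 1))))"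
    unfolding rqfac_pascal[OF assms] distrib_left sum.distrib ..
  also have "(\<Sum>t=0..M. f t * (rqfac q (M - t - 1) * rqfac q t)) =
      (\<Sum>t=0..M-1. f t * (rqfac q (M - 1 - t) * rqfac q t))"
    by (rule sum.mono_neutral_cong_right) (auto simp: algebra_simps)
  also have "(\<Sum>t=0..M. f t * (q powi (M - t) * (rqfac q (M - t) * rqfac q (t - 1)))) =
      (\<Sum>t=1..M. f t * (q powi (M - t) * (rqfac q (M - t) * rqfac q (t - 1))))"
    by (rule sum.mono_neutral_right) auto
  also have "\<dots> = (\<Sum>t=0..M-1. f (t + 1) * (q powi (M - 1 - t) * (rqfac q (M - 1 - t) * rqfac q t)))"
    by (rule sum.reindex_bij_witness[of _ "\<lambda>t. t + 1" "\<lambda>t. t - 1"]) auto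
  finally show ?thesis
    by (simp add: sum.distrib[symmetric] algebra_simps)
qed

lemma q_vandermonde:
  assumes "q \<noteq> 0" "not_root_of_unity q"
  shows "(\<Sum>t=0..M. q powi (t * (t + c)) * rqfac q (t + c) * (rqfac q (M - t) * rqfac q t)) =
    rqfac q M * rqfac q (M + c)"
proof (cases "M \<ge> 0")
  case True
  then show ?thesis
  proof (induction M arbitrary: c rule: int_ge_induct)
    case (step M)
    let ?S = "\<lambda>M c. \<Sum>t=0..M. q powi (t * (t + c)) * rqfac q (t + c) * (rqfac q (M - t) * rqfac q t)"
    have shift: "q powi (M - t) * (q powi ((t + 1) * (t + 1 + c)) * rqfac q (t + 1 + c)) =
        q powi (M + 1 + c) * (q powi (t * (t + (c + 1))) * rqfac q (t + (c + 1)))" for t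
    proof -
      have "q powi (M - t) * q powi ((t + 1) * (t + 1 + c)) =
          q powi (M + 1 + c) * q powi (t * (t + (c + 1)))"
        using assms(1) by (simp add: algebra_simps flip: power_int_add)
      then show ?thesis
        by (simp add: mult.assoc[symmetric] add_ac)
    qed
    have "(1 - q powi (M + 1)) * ?S (M + 1) c = ?S M c + q powi (M + 1 + c) * ?S M (c + 1)"
      unfolding sum_rqfac_pascal[OF assms] add_diff_cancel_right' shift
      by (simp add: distrib_right sum.distrib sum_distrib_left mult.assoc)
    also have "\<dots> = rqfac q M * (rqfac q (M + 1 + c - 1) + q powi (M + 1 + c) * rqfac q (M + 1 + c))"
      unfolding step.IH by (simp add: algebra_simps)
    also have "\<dots> = rqfac q (M + 1 - 1) * rqfac q (M + 1 + c)"
      unfolding rqfac_pred[OF assms(2), of "M + 1 + c"] by (simp add: algebra_simps)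
    also have "\<dots> = (1 - q powi (M + 1)) * (rqfac q (M + 1) * rqfac q (M + 1 + c))"
      unfolding rqfac_pred[OF assms(2)] by (rule mult.assoc)
    finally show ?case
      using step.hyps power_int_eq_1_iff[OF assms(2), of "M + 1"] by simp
  qed simp
qed simp

definition choose_two :: "int \<Rightarrow> int" where
  "choose_two j = j * (j - 1) div 2"

lemma two_times_choose_two: "2 * choose_two j = j\<^sup>2 - j"
  by (simp add: choose_two_def power2_eq_square algebra_simps)

lemma choose_two_add: "choose_two (i + j) = choose_two i + choose_two j + i * j"
  using two_times_choose_two[of i] two_times_choose_two[of j] two_times_choose_two[of "i + j"]
  by (simp add: power2_eq_square algebra_simps)

lemma choose_two_minus: "choose_two (- j) = choose_two j + j"
  using two_times_choose_two[of j] two_times_choose_two[of "- j"] by simp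

lemma power_int_choose_two:
  fixes q :: "'a::field"
  shows "(q ^ (2 * n)) powi choose_two j = q powi (int n * (j\<^sup>2 - j))"
proof -
  have "int n * (j\<^sup>2 - j) = int (2 * n) * choose_two j"
    unfolding two_times_choose_two[symmetric] by simp
  then show ?thesis
    by (simp only: power_int_mult power_int_of_nat)
qed

lemma choose_two_0 [simp]: "choose_two 0 = 0" and choose_two_1 [simp]: "choose_two 1 = 0"
  by (simp_all add: choose_two_def)

lemma q_binomial_theorem:
  assumes "q \<noteq> 0" "not_root_of_unity q"
  shows "(\<Sum>t=0..int n. (-1) powi t * q powi choose_two t * x powi t *
      (rqfac q (int n - t) * rqfac q t)) =
    qpoch_fin x q n * rqfac q (int n)"
proof (induction n)
  case (Suc n)
  let ?f = "\<lambda>t. (-1) powi t * q powi choose_two t * x powi t"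
  have shift: "q powi (int n - t) * ?f (t + 1) = - (x * q ^ n) * ?f t" if "t \<ge> 0" for t
  proof -
    have "x powi (t + 1) = x powi t * x"
      using that by (intro power_int_add_1) auto
    moreover have "q powi (int n - t) * q powi choose_two (t + 1) = q ^ n * q powi choose_two t"
      using assms(1) by (simp add: choose_two_add power_int_add power_int_diff)
    ultimately show ?thesis
      by (simp add: power_int_add mult_ac)
  qed
  have "(1 - q powi (int n + 1)) * (\<Sum>t=0..int n + 1. ?f t * (rqfac q (int n + 1 - t) * rqfac q t)) =
      (\<Sum>t=0..int n. (?f t + q powi (int n - t) * ?f (t + 1)) * (rqfac q (int n - t) * rqfac q t))"
    unfolding sum_rqfac_pascal[OF assms] by simp
  also have "\<dots> = (\<Sum>t=0..int n. (1 - x * q ^ n) * (?f t * (rqfac q (int n - t) * rqfac q t)))"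
    by (rule sum.cong[OF refl], subst shift) (auto simp: algebra_simps)
  also have "\<dots> = (1 - x * q ^ n) * (qpoch_fin x q n * rqfac q (int n))"
    by (simp add: sum_distrib_left[symmetric] Suc.IH)
  also have "\<dots> = (1 - q powi (int n + 1)) * (qpoch_fin x q (Suc n) * rqfac q (int n + 1))"
    using rqfac_pred[OF assms(2), of "int n + 1"] by (simp add: qpoch_fin_Suc)
  finally show ?case
    using power_int_eq_1_iff[OF assms(2), of "int n + 1"] by (simp add: add.commute)
qed simp

lemma q_binomial_theorem_shifted:
  assumes "q \<noteq> 0" "not_root_of_unity q" "x \<noteq> 0"
  shows "(\<Sum>j=a..b. (-1) powi j * q powi choose_two j * x powi j *
      (rqfac q (b - j) * rqfac q (j - a))) =
    (-1) powi b * q powi choose_two b * x powi b *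
      (qpoch_fin (q powi (1 - b) / x) q (nat (b - a)) * rqfac q (b - a))"
proof (cases "a \<le> b")
  case True
  define n where "n = nat (b - a)"
  let ?y = "q powi (1 - b) / x"
  have summand: "(-1) powi (b - t) * q powi choose_two (b - t) * x powi (b - t) =
      (-1) powi b * q powi choose_two b * x powi b *
        ((-1) powi t * q powi choose_two t * ?y powi t)" for t
  proof -
    have "choose_two (b - t) = choose_two b + (choose_two t + (1 - b) * t)"
      using choose_two_add[of b "- t"] by (simp add: choose_two_minus algebra_simps)
    then have "q powi choose_two (b - t) =
        q powi choose_two b * (q powi choose_two t * (q powi (1 - b)) powi t)"
      using assms(1) by (simp add: power_int_add power_int_mult)
    moreover have "x powi (b - t) = x powi b / x powi t"
      using assms(3) by (simp add: power_int_diff)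
    moreover have "(-1 :: 'a) powi (b - t) = (-1) powi b * (-1) powi t"
      by (simp add: power_int_diff power_int_minus_left)
    ultimately show ?thesis
      by (simp add: power_int_divide_distrib)
  qed
  have "(\<Sum>j=a..b. (-1) powi j * q powi choose_two j * x powi j *
      (rqfac q (b - j) * rqfac q (j - a))) =
    (\<Sum>t=0..int n. (-1) powi (b - t) * q powi choose_two (b - t) * x powi (b - t) *
      (rqfac q (int n - t) * rqfac q t))"
    by (rule sum.reindex_bij_witness[of _ "\<lambda>t. b - t" "\<lambda>j. b - j"])
       (use True in \<open>auto simp: n_def algebra_simps\<close>)
  also have "\<dots> = (-1) powi b * q powi choose_two b * x powi b *
      (\<Sum>t=0..int n. (-1) powi t * q powi choose_two t * ?y powi t *
        (rqfac q (int n - t) * rqfac q t))"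
    unfolding summand by (simp add: sum_distrib_left mult.assoc)
  also have "\<dots> = (-1) powi b * q powi choose_two b * x powi b *
      (qpoch_fin ?y q n * rqfac q (int n))"
    unfolding q_binomial_theorem[OF assms(1,2)] ..
  finally show ?thesis
    using True by (simp add: n_def)
qed simp

section \<open>A quadratic change of base\<close>

lemma rqfac_square_pred:
  assumes "not_root_of_unity q"
  shows "rqfac (q\<^sup>2) (k - 1) = (1 - q powi (2 * k)) * rqfac (q\<^sup>2) k"
  using rqfac_pred[OF not_root_of_unity_power[OF assms, of 2], of k] by (simp add: power_int_mult)

definition base_change_summand :: "'a::field \<Rightarrow> int \<Rightarrow> int \<Rightarrow> int \<Rightarrow> 'a" where
  "base_change_summand q c M t = q powi t * qpoch_fin (-1) q (nat (c + 2 * t)) *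
    (rqfac (q\<^sup>2) (M - t) * rqfac (q\<^sup>2) t * rqfac (q\<^sup>2) (t + c))"

lemma base_change_summand_eq_0: "t < 0 \<or> M < t \<or> t + c < 0 \<Longrightarrow> base_change_summand q c M t = 0"
  by (auto simp: base_change_summand_def)

lemma base_change_summand_pred:
  assumes "not_root_of_unity q"
  shows "base_change_summand q c (M - 1) t =
      (1 - q powi (2 * (M - t))) * base_change_summand q c M t"
proof -
  have "rqfac (q\<^sup>2) (M - 1 - t) = (1 - q powi (2 * (M - t))) * rqfac (q\<^sup>2) (M - t)"
    using rqfac_square_pred[OF assms, of "M - t"] by (simp add: algebra_simps)
  then show ?thesis
    unfolding base_change_summand_def by (simp only: mult_ac)
qed

lemma base_change_summand_succ:
  assumes "q \<noteq> 0" "not_root_of_unity q"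
  shows "(1 - q powi (2 * (t + 1))) * (1 - q powi (2 * (t + 1 + c))) *
      base_change_summand q c M (t + 1) =
    q * (1 + q powi (c + 2 * t)) * (1 + q powi (c + 2 * t + 1)) * (1 - q powi (2 * (M - t))) *
      base_change_summand q c M t"
proof (cases "t < 0 \<or> t + c < 0")
  case True
  then consider "t + 1 = 0" | "t + 1 + c = 0" | "t + 1 < 0" | "t + 1 + c < 0"
    by linarith
  then have "(1 - q powi (2 * (t + 1))) * (1 - q powi (2 * (t + 1 + c))) *
      base_change_summand q c M (t + 1) = 0"
    by cases (simp_all add: base_change_summand_eq_0)
  moreover have "base_change_summand q c M t = 0"
    using True by (auto simp: base_change_summand_eq_0)
  ultimately show ?thesis
    by simp
next
  case False
  then have "0 \<le> c + 2 * t"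
    by linarith
  then have "nat (c + 2 * (t + 1)) = Suc (Suc (nat (c + 2 * t)))"
    using nat_add_distrib[of "c + 2 * t" 2] by (simp add: add.assoc)
  moreover have "q powi (c + 2 * t) = q ^ nat (c + 2 * t)"
    using False by (simp add: power_int_nonneg_exp)
  ultimately have "qpoch_fin (-1) q (nat (c + 2 * (t + 1))) =
      qpoch_fin (-1) q (nat (c + 2 * t)) * (1 + q powi (c + 2 * t)) * (1 + q powi (c + 2 * t + 1))"
    using assms(1) by (simp add: qpoch_fin_Suc power_int_add_1')
  moreover have "rqfac (q\<^sup>2) (M - (t + 1)) = (1 - q powi (2 * (M - t))) * rqfac (q\<^sup>2) (M - t)"
    using rqfac_square_pred[OF assms(2), of "M - t"] by (simp add: algebra_simps)
  moreover have "rqfac (q\<^sup>2) t = (1 - q powi (2 * (t + 1))) * rqfac (q\<^sup>2) (t + 1)"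
    using rqfac_square_pred[OF assms(2), of "t + 1"] by simp
  moreover have "rqfac (q\<^sup>2) (t + c) = (1 - q powi (2 * (t + 1 + c))) * rqfac (q\<^sup>2) (t + 1 + c)"
    using rqfac_square_pred[OF assms(2), of "t + 1 + c"] by (simp add: algebra_simps)
  ultimately show ?thesis
    unfolding base_change_summand_def using assms(1)
    by (simp only: power_int_add_1 mult_ac simp_thms)
qed

text \<open>Certificate for creative telescoping. The sum turns out to be proportional to
  \<open>R\<^sub>M = 1 / ((q)\<^sub>M (q)\<^sub>M\<^sub>+\<^sub>c)\<close>, where \<open>(1 - q\<^sup>M) (1 - q\<^sup>M\<^sup>+\<^sup>c) R\<^sub>M = R\<^sub>M\<^sub>-\<^sub>1\<close>. That recurrence has no
  certificate because only \<open>q\<^sup>2\<^sup>M\<close> enters the summand; the one below arises from it and its shift by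
  eliminating the odd powers of \<open>q\<^sup>M\<close>.\<close>

definition base_change_certificate :: "'a::field \<Rightarrow> int \<Rightarrow> int \<Rightarrow> int \<Rightarrow> 'a" where
  "base_change_certificate q c M t =
    - (q powi (2 * (M - t)) * (1 - q powi (2 * t)) * (1 - q powi (2 * (t + c))) *
       base_change_summand q c M t)"

lemma base_change_summand_telescoping:
  fixes q :: "'a::field" and c M t :: int
  assumes "q \<noteq> 0" "not_root_of_unity q"
  defines "F \<equiv> base_change_summand q c" and "G \<equiv> base_change_certificate q c M"
  shows "(1 - q powi (2 * M)) * (1 - q powi (2 * (M + c))) * F M t
      - (1 + q) * (1 + q powi (2 * M + c - 1)) * F (M - 1) t + q * F (M - 2) t = G (t + 1) - G t"
proof -
  define T Z X where "T = q powi (2 * t)" and "Z = q powi c" and "X = q powi (2 * (M - t))"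
  have powers: "q powi (2 * M) = X * T" "q powi (2 * (M + c)) = X * T * Z\<^sup>2"
    "q powi (2 * M + c - 1) = X * T * Z / q" "q powi (2 * (t + c)) = T * Z\<^sup>2"
    "q powi (c + 2 * t) = Z * T" "q powi (c + 2 * t + 1) = Z * T * q"
    "q powi (2 * (M - (t + 1))) = X / q\<^sup>2"  "q powi (2 * (M - 1 - t)) = X / q\<^sup>2"
    unfolding T_def Z_def X_def using assms(1)
    by (simp_all add: algebra_simps power_int_add power_int_diff power_int_mult)
  have pred: "F (M - 1) t = (1 - X) * F M t"
    unfolding F_def X_def by (rule base_change_summand_pred[OF assms(2)])
  have pred': "F (M - 2) t = (1 - X / q\<^sup>2) * F (M - 1) t"
    using base_change_summand_pred[OF assms(2), of c "M - 1" t] powers by (simp add: F_def)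
  have G_succ: "G (t + 1) = - (X / q\<^sup>2 * (q * (1 + Z * T) * (1 + Z * T * q) * (1 - X) * F M t))"
    using base_change_summand_succ[OF assms(1,2), of t c M]
    unfolding G_def base_change_certificate_def F_def powers X_def[symmetric]
    by (simp only: mult.assoc)
  have G_eq: "G t = - (X * (1 - T) * (1 - T * Z\<^sup>2) * F M t)"
    unfolding G_def F_def base_change_certificate_def powers X_def T_def ..
  show ?thesis
    unfolding G_succ G_eq powers pred' pred using assms(1) by (simp add: field_simps power2_eq_square)
qed

lemma base_change_sum_recurrence:
  fixes q :: "'a::field" and c M :: int
  assumes "q \<noteq> 0" "not_root_of_unity q"
  defines "S \<equiv> \<lambda>M. \<Sum>t=0..M. base_change_summand q c M t"
  shows "(1 - q powi (2 * M)) * (1 - q powi (2 * (M + c))) * S M =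
    (1 + q) * (1 + q powi (2 * M + c - 1)) * S (M - 1) - q * S (M - 2)"
proof (cases "M \<ge> 0")
  case True
  let ?G = "base_change_certificate q c M"
  have S: "S K = (\<Sum>t=0..M. base_change_summand q c K t)" if "K \<le> M" for K
    unfolding S_def
    by (rule sum.mono_neutral_left) (use that in \<open>auto simp: base_change_summand_eq_0\<close>)
  have "(1 - q powi (2 * M)) * (1 - q powi (2 * (M + c))) * S M
      - (1 + q) * (1 + q powi (2 * M + c - 1)) * S (M - 1) + q * S (M - 2) =
      (\<Sum>t=0..M. ?G (t + 1) - ?G t)"
    unfolding base_change_summand_telescoping[OF assms(1,2), symmetric]
    by (simp add: S sum_distrib_left sum.distrib sum_subtractf)
  also have "\<dots> = (\<Sum>n<nat (M + 1). ?G (int (Suc n)) - ?G (int n))"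
    by (rule sum.reindex_bij_witness[of _ int nat]) (use True in \<open>auto simp: add.commute\<close>)
  also have "\<dots> = ?G (M + 1) - ?G 0"
    using True sum_lessThan_telescope[of "\<lambda>n. ?G (int n)" "nat (M + 1)"] by simp
  also have "\<dots> = 0"
    by (simp add: base_change_certificate_def base_change_summand_eq_0)
  finally show ?thesis
    by (simp add: algebra_simps)
qed (simp add: S_def)

lemma rqfac_product_recurrence:
  fixes q :: "'a::field" and c M :: int
  assumes "q \<noteq> 0" "not_root_of_unity q"
  defines "R \<equiv> \<lambda>M. rqfac q M * rqfac q (M + c)"
  shows "(1 - q powi (2 * M)) * (1 - q powi (2 * (M + c))) * R M =
    (1 + q) * (1 + q powi (2 * M + c - 1)) * R (M - 1) - q * R (M - 2)"
proof -
  define Q Z where "Q = q powi M" and "Z = q powi c"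
  have pred: "R (k - 1) = (1 - q powi k) * (1 - q powi (k + c)) * R k" for k
  proof -
    have "R (k - 1) = rqfac q (k - 1) * rqfac q (k + c - 1)"
      by (simp add: R_def algebra_simps)
    then show ?thesis
      unfolding rqfac_pred[OF assms(2)] by (simp only: R_def mult_ac)
  qed
  have R_pred: "R (M - 1) = (1 - Q) * (1 - Q * Z) * R M"
    using assms(1) by (simp add: pred Q_def Z_def power_int_add)
  have R_pred2: "R (M - 2) = (1 - Q / q) * (1 - Q * Z / q) * R (M - 1)"
    using pred[of "M - 1"] assms(1) by (simp add: Q_def Z_def power_int_add power_int_diff)
  have powers: "q powi (2 * M) = Q\<^sup>2" "q powi (2 * (M + c)) = Q\<^sup>2 * Z\<^sup>2"
    "q powi (2 * M + c - 1) = Q\<^sup>2 * Z / q"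
    unfolding Q_def Z_def using assms(1)
    by (simp_all add: algebra_simps power_int_add power_int_diff power_int_mult)
  show ?thesis
    unfolding R_pred2 R_pred powers using assms(1) by (simp add: field_simps power2_eq_square)
qed

lemma qpoch_fin_minus_1:
  "qpoch_fin (-1) q n * (1 + q ^ n) * qpoch_fin q q n = 2 * qpoch_fin (q\<^sup>2) (q\<^sup>2) n"
proof (induction n)
  case (Suc n)
  have square: "(q ^ Suc n)\<^sup>2 = q\<^sup>2 * (q\<^sup>2) ^ n"
    by (simp add: power_mult_distrib mult.commute flip: power_mult)
  have "qpoch_fin (-1) q (Suc n) * (1 + q ^ Suc n) * qpoch_fin q q (Suc n) =
      qpoch_fin (-1) q n * (1 + q ^ n) * qpoch_fin q q n * (1 - (q ^ Suc n)\<^sup>2)"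
    by (simp add: qpoch_fin_Suc power2_eq_square algebra_simps)
  also have "\<dots> = 2 * qpoch_fin (q\<^sup>2) (q\<^sup>2) (Suc n)"
    unfolding Suc.IH square by (simp add: qpoch_fin_Suc)
  finally show ?case .
qed simp

lemma qpoch_fin_minus_1_rqfac:
  assumes "not_root_of_unity q" "k \<ge> 0"
  shows "(1 + q powi k) * qpoch_fin (-1) q (nat k) * rqfac (q\<^sup>2) k = 2 * rqfac q k"
  using qpoch_fin_minus_1[of q "nat k"] assms(2)
    qpoch_fin_self_nonzero[OF assms(1)]
    qpoch_fin_self_nonzero[OF not_root_of_unity_power[OF assms(1), of 2]]
  by (simp add: rqfac_def power_int_nonneg_exp field_simps)

lemma quadratic_base_change_sum_initial:
  fixes q :: "'a::field" and c :: int
  assumes "q \<noteq> 0" "not_root_of_unity q"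
  defines "K \<equiv> max 0 (- c)"
  shows "(1 + q powi c) * (\<Sum>t=0..K. base_change_summand q c K t) =
      2 * (rqfac q K * rqfac q (K + c))"
proof -
  have "(\<Sum>t=0..K. base_change_summand q c K t) = (\<Sum>t\<in>{K}. base_change_summand q c K t)"
    by (rule sum.mono_neutral_right) (auto simp: K_def intro!: base_change_summand_eq_0)
  moreover have "(1 + q powi c) * base_change_summand q c K K = 2 * (rqfac q K * rqfac q (K + c))"
  proof (cases "c \<ge> 0")
    case True
    then show ?thesis
      using qpoch_fin_minus_1_rqfac[OF assms(2) True]
      by (simp add: K_def base_change_summand_def mult.assoc)
  next
    case False
    then have "(1 + q powi c) * q powi (- c) = 1 + q powi (- c)"
      using assms(1) by (simp add: power_int_minus field_simps)
    with False show ?thesis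
      using qpoch_fin_minus_1_rqfac[OF assms(2), of "- c"]
      by (simp add: K_def base_change_summand_def mult.assoc[symmetric])
  qed
  ultimately show ?thesis
    by simp
qed

lemma quadratic_base_change_sum:
  fixes q :: "'a::field" and c M :: int
  assumes "q \<noteq> 0" "not_root_of_unity q"
  shows "(1 + q powi c) * (\<Sum>t=0..M. base_change_summand q c M t) =
      2 * (rqfac q M * rqfac q (M + c))"
    (is "_ * ?S M = 2 * ?R M")
proof (induction "nat (M - max 0 (- c))" arbitrary: M rule: less_induct)
  case less
  consider (below) "M < max 0 (- c)" | (initial) "M = max 0 (- c)" | (above) "max 0 (- c) < M"
    by linarith
  then show ?case
  proof cases
    case below
    then have "?S M = 0"
      by (intro sum.neutral) (auto intro!: base_change_summand_eq_0)
    moreover have "?R M = 0"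
      using below by (cases "M < 0") auto
    ultimately show ?thesis
      by simp
  next
    case initial
    then show ?thesis
      by (simp only: quadratic_base_change_sum_initial[OF assms])
  next
    case above
    have IH: "(1 + q powi c) * ?S (M - 1) = 2 * ?R (M - 1)"
      "(1 + q powi c) * ?S (M - 2) = 2 * ?R (M - 2)"
      using above by (auto intro!: less)
    define u where "u = (1 - q powi (2 * M)) * (1 - q powi (2 * (M + c)))"
    have "u * ((1 + q powi c) * ?S M) = (1 + q powi c) *
        ((1 + q) * (1 + q powi (2 * M + c - 1)) * ?S (M - 1) - q * ?S (M - 2))"
      unfolding u_def mult.left_commute[of _ "1 + q powi c"] base_change_sum_recurrence[OF assms] ..
    also have "\<dots> = 2 * ((1 + q) * (1 + q powi (2 * M + c - 1)) * ?R (M - 1) - q * ?R (M - 2))"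
      unfolding right_diff_distrib mult.left_commute[of "1 + q powi c"] mult.left_commute[of 2] IH
      ..
    also have "\<dots> = u * (2 * ?R M)"
      unfolding u_def mult.left_commute[of _ 2] rqfac_product_recurrence[OF assms] ..
    finally show ?thesis
      using above power_int_eq_1_iff[OF assms(2)] unfolding u_def by simp
  qed
qed

section \<open>Bilateral Bailey pairs\<close>

definition bailey_kernel :: "'a::field \<Rightarrow> int \<Rightarrow> int \<Rightarrow> int \<Rightarrow> 'a" where
  "bailey_kernel q m n j = rqfac q (n - j) * rqfac q (n + j + m)"

lemma bailey_kernel_eq_0: "n < j \<or> n + j + m < 0 \<Longrightarrow> bailey_kernel q m n j = 0"
  by (auto simp: bailey_kernel_def)

lemma bailey_kernel_shift:
  assumes "not_root_of_unity q"
  shows "bailey_kernel q (m - 1) n (j + 1) = (1 - q powi (n - j)) * bailey_kernel q m n j"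
proof -
  have "bailey_kernel q (m - 1) n (j + 1) = rqfac q (n - j - 1) * rqfac q (n + j + m)"
    by (simp add: bailey_kernel_def algebra_simps)
  then show ?thesis
    unfolding rqfac_pred[OF assms] by (simp add: bailey_kernel_def mult.assoc)
qed

lemma sum_bailey_kernel:
  assumes "L \<le> - (m div 2)"
  shows "(\<Sum>n=L..N. f n * bailey_kernel q m n j) =
    (\<Sum>t=0..N-j. f (j + t) * (rqfac q t * rqfac q (t + (2 * j + m))))"
proof -
  have "(\<Sum>n=L..N. f n * bailey_kernel q m n j) = (\<Sum>n=min L j..N. f n * bailey_kernel q m n j)"
  proof (rule sum.mono_neutral_left)
    show "\<forall>n\<in>{min L j..N} - {L..N}. f n * bailey_kernel q m n j = 0"
    proof
      fix n assume "n \<in> {min L j..N} - {L..N}"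
      then have "j \<le> n" "n < L"
        by auto
      then have "n + j + m < 0"
        using assms by linarith
      then show "f n * bailey_kernel q m n j = 0"
        by (simp add: bailey_kernel_eq_0)
    qed
  qed auto
  also have "\<dots> = (\<Sum>n=j..N. f n * bailey_kernel q m n j)"
    by (rule sum.mono_neutral_right) (auto simp: bailey_kernel_eq_0)
  also have "\<dots> = (\<Sum>t=0..N-j. f (j + t) * (rqfac q t * rqfac q (t + (2 * j + m))))"
    by (rule sum.reindex_bij_witness[of _ "\<lambda>t. j + t" "\<lambda>n. n - j"])
       (auto simp: bailey_kernel_def algebra_simps)
  finally show ?thesis .
qed

lemma bailey_kernel_chain_step:
  assumes "q \<noteq> 0" "not_root_of_unity q" "L \<le> - (m div 2)"
  shows "(\<Sum>n=L..N. q powi (n\<^sup>2 + m * n) * rqfac q (N - n) * bailey_kernel q m n j) =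
    q powi (j\<^sup>2 + m * j) * bailey_kernel q m N j"
proof -
  have "q powi ((j + t)\<^sup>2 + m * (j + t)) =
      q powi (j\<^sup>2 + m * j) * q powi (t * (t + (2 * j + m)))" for t
    using assms(1) by (simp add: algebra_simps power2_eq_square flip: power_int_add)
  then have "(\<Sum>n=L..N. q powi (n\<^sup>2 + m * n) * rqfac q (N - n) * bailey_kernel q m n j) =
      q powi (j\<^sup>2 + m * j) * (\<Sum>t=0..N-j. q powi (t * (t + (2 * j + m))) * rqfac q (t + (2 * j + m)) *
        (rqfac q (N - j - t) * rqfac q t))"
    unfolding sum_bailey_kernel[OF assms(3)] sum_distrib_left
    by (intro sum.cong) (simp_all add: mult_ac diff_diff_eq)
  also have "\<dots> = q powi (j\<^sup>2 + m * j) * bailey_kernel q m N j"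
    unfolding q_vandermonde[OF assms(1,2)] by (simp add: bailey_kernel_def algebra_simps)
  finally show ?thesis .
qed

text \<open>Splitting \<open>1 = (1 - q\<^sup>n\<^sup>-\<^sup>j) + q\<^sup>n\<^sup>-\<^sup>j\<close> gives one chain step with parameters \<open>m - 1\<close> and \<open>j + 1\<close>
  and one with parameters \<open>m\<close> and \<open>j\<close>.\<close>

lemma bailey_kernel_shifted_step:
  assumes "q \<noteq> 0" "not_root_of_unity q" "L \<le> - (m div 2)"
  shows "(\<Sum>n=L..N. q powi (n\<^sup>2 + (m - 1) * n) * rqfac q (N - n) * bailey_kernel q m n j) =
    q powi (j\<^sup>2 + (m - 1) * j) * (1 + q powi (2 * j + m) - q powi (N + j + m)) *
      bailey_kernel q m N j"
proof -
  have powers: "q powi (n\<^sup>2 + (m - 1) * n) * q powi (n - j) =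
      q powi (- j) * q powi (n\<^sup>2 + m * n)" for n
    using assms(1) by (simp add: algebra_simps flip: power_int_add)
  have summand: "q powi (n\<^sup>2 + (m - 1) * n) * rqfac q (N - n) * bailey_kernel q m n j =
      q powi (n\<^sup>2 + (m - 1) * n) * rqfac q (N - n) * bailey_kernel q (m - 1) n (j + 1) +
      q powi (- j) * (q powi (n\<^sup>2 + m * n) * rqfac q (N - n) * bailey_kernel q m n j)" for n
    unfolding bailey_kernel_shift[OF assms(2)] mult.assoc[symmetric] powers[symmetric]
    by (simp add: algebra_simps)
  have "L \<le> - ((m - 1) div 2)"
    using assms(3) by linarith
  note steps = bailey_kernel_chain_step[OF assms(1,2) this] bailey_kernel_chain_step[OF assms]
  have "(\<Sum>n=L..N. q powi (n\<^sup>2 + (m - 1) * n) * rqfac q (N - n) * bailey_kernel q m n j) =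
      q powi ((j + 1)\<^sup>2 + (m - 1) * (j + 1)) * bailey_kernel q (m - 1) N (j + 1) +
      q powi (- j) * (q powi (j\<^sup>2 + m * j) * bailey_kernel q m N j)"
    unfolding summand sum.distrib sum_distrib_left[symmetric] steps ..
  also have "q powi ((j + 1)\<^sup>2 + (m - 1) * (j + 1)) = q powi (j\<^sup>2 + (m - 1) * j) * q powi (2 * j + m)"
    using assms(1) by (simp add: algebra_simps power2_eq_square flip: power_int_add)
  also have "q powi (- j) * (q powi (j\<^sup>2 + m * j) * bailey_kernel q m N j) =
      q powi (j\<^sup>2 + (m - 1) * j) * bailey_kernel q m N j"
    unfolding mult.assoc[symmetric] powers[of j, symmetric] by simp
  also have "q powi (j\<^sup>2 + (m - 1) * j) * q powi (2 * j + m) * bailey_kernel q (m - 1) N (j + 1) +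
      q powi (j\<^sup>2 + (m - 1) * j) * bailey_kernel q m N j =
      q powi (j\<^sup>2 + (m - 1) * j) * (1 + q powi (2 * j + m) - q powi (2 * j + m) * q powi (N - j)) *
        bailey_kernel q m N j"
    unfolding bailey_kernel_shift[OF assms(2)] by (simp add: algebra_simps)
  also have "q powi (2 * j + m) * q powi (N - j) = q powi (N + j + m)"
    using assms(1) by (simp add: algebra_simps flip: power_int_add)
  finally show ?thesis .
qed

lemma one_plus_power_int_nonzero:
  fixes q :: "'a::field_char_0"
  assumes "not_root_of_unity q"
  shows "1 + q powi k \<noteq> 0"
proof
  assume "1 + q powi k = 0"
  then have "q powi k = - 1"
    by (simp add: add_eq_0_iff)
  moreover from this have "k = 0"
    using power_int_eq_1_iff[OF assms, of "k * 2"] by (simp add: power_int_mult)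
  ultimately show False
    by simp
qed

lemma bailey_kernel_base_change:
  fixes q :: "'a::field_char_0"
  assumes "q \<noteq> 0" "not_root_of_unity q" "L \<le> - (m div 2)"
  shows "(\<Sum>n=L..N. q powi n * qpoch_fin (-1) q (nat (m + 2 * n)) / 2 *
      rqfac (q\<^sup>2) (N - n) * bailey_kernel (q\<^sup>2) m n j) =
    q powi j / (1 + q powi (2 * j + m)) * bailey_kernel q m N j"
proof -
  have "(\<Sum>n=L..N. q powi n * qpoch_fin (-1) q (nat (m + 2 * n)) / 2 *
      rqfac (q\<^sup>2) (N - n) * bailey_kernel (q\<^sup>2) m n j) =
      q powi j / 2 * (\<Sum>t=0..N-j. base_change_summand q (2 * j + m) (N - j) t)"
    unfolding sum_bailey_kernel[OF assms(3)] sum_distrib_left base_change_summand_def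
    using assms(1) by (intro sum.cong) (simp_all add: power_int_add algebra_simps)
  also have "(\<Sum>t=0..N-j. base_change_summand q (2 * j + m) (N - j) t) =
      2 * (rqfac q (N - j) * rqfac q (N - j + (2 * j + m))) / (1 + q powi (2 * j + m))"
    using quadratic_base_change_sum[OF assms(1,2), of "2 * j + m" "N - j"]
      one_plus_power_int_nonzero[OF assms(2), of "2 * j + m"] by (simp add: field_simps)
  finally show ?thesis
    by (simp add: bailey_kernel_def algebra_simps)
qed

text \<open>With \<open>y = q\<^sup>2\<^sup>j\<^sup>+\<^sup>m\<close>, the factor in front is the quotient
  \<open>(1 - y\<^sup>e\<^sup>+\<^sup>1 - q\<^sup>n\<^sup>+\<^sup>j\<^sup>+\<^sup>m (1 - y\<^sup>e)) / (1 - y)\<close> of the Bailey lattice with the division carried out, so that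
  \<open>2j + m = 0\<close> is not exceptional.\<close>

definition lattice_kernel :: "'a::field \<Rightarrow> int \<Rightarrow> nat \<Rightarrow> int \<Rightarrow> int \<Rightarrow> 'a" where
  "lattice_kernel q m e n j =
    ((\<Sum>k\<le>e. (q powi (2 * j + m)) ^ k) - q powi (n + j + m) * (\<Sum>k<e. (q powi (2 * j + m)) ^ k)) *
    bailey_kernel q m n j"

lemma lattice_kernel_0 [simp]: "lattice_kernel q m 0 = bailey_kernel q m"
  by (simp add: lattice_kernel_def fun_eq_iff)

lemma lattice_kernel_eq_0: "n < j \<or> n + j + m < 0 \<Longrightarrow> lattice_kernel q m e n j = 0"
  by (simp add: lattice_kernel_def bailey_kernel_eq_0)

lemma lattice_kernel_step:
  assumes "q \<noteq> 0" "not_root_of_unity q" "L \<le> - (m div 2)"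
  shows "(\<Sum>n=L..N. q powi (n\<^sup>2 + (m - 1) * n) * rqfac q (N - n) * lattice_kernel q m e n j) =
    q powi (j\<^sup>2 + (m - 1) * j) * lattice_kernel q m (Suc e) N j"
proof -
  define y A where "y = q powi (2 * j + m)" and "A = (\<Sum>k<e. y ^ k)"
  have partial_sums: "(\<Sum>k<e. y ^ k) = A" "(\<Sum>k\<le>e. y ^ k) = A + y ^ e"
    "(\<Sum>k<Suc e. y ^ k) = A + y ^ e" "(\<Sum>k\<le>Suc e. y ^ k) = A + y ^ e + y * y ^ e"
    by (simp_all add: A_def lessThan_Suc_atMost[symmetric])
  have powers: "q powi (n\<^sup>2 + (m - 1) * n) * q powi (n + j + m) =
      q powi (j + m) * q powi (n\<^sup>2 + m * n)" for n
    using assms(1) by (simp add: algebra_simps flip: power_int_add)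
  have summand: "q powi (n\<^sup>2 + (m - 1) * n) * rqfac q (N - n) * lattice_kernel q m e n j =
      (A + y ^ e) * (q powi (n\<^sup>2 + (m - 1) * n) * rqfac q (N - n) * bailey_kernel q m n j) -
      A * q powi (j + m) * (q powi (n\<^sup>2 + m * n) * rqfac q (N - n) * bailey_kernel q m n j)" for n
  proof -
    have "A * q powi (j + m) * (q powi (n\<^sup>2 + m * n) * rqfac q (N - n) * bailey_kernel q m n j) =
        A * (q powi (n\<^sup>2 + (m - 1) * n) * q powi (n + j + m)) * rqfac q (N - n) *
          bailey_kernel q m n j"
      unfolding powers by (simp only: mult_ac)
    then show ?thesis
      unfolding lattice_kernel_def y_def[symmetric] partial_sums by (simp add: algebra_simps)
  qed
  have "(\<Sum>n=L..N. q powi (n\<^sup>2 + (m - 1) * n) * rqfac q (N - n) * lattice_kernel q m e n j) =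
      (A + y ^ e) * (q powi (j\<^sup>2 + (m - 1) * j) * (1 + y - q powi (N + j + m)) *
          bailey_kernel q m N j) -
      A * (q powi (j + m) * q powi (j\<^sup>2 + m * j)) * bailey_kernel q m N j"
    unfolding summand sum_subtractf sum_distrib_left[symmetric] bailey_kernel_chain_step[OF assms]
      bailey_kernel_shifted_step[OF assms] y_def by (simp only: mult.assoc)
  also have "q powi (j + m) * q powi (j\<^sup>2 + m * j) = q powi (j\<^sup>2 + (m - 1) * j) * y"
    unfolding y_def using assms(1) by (simp add: algebra_simps flip: power_int_add)
  also have "(A + y ^ e) *
      (q powi (j\<^sup>2 + (m - 1) * j) * (1 + y - q powi (N + j + m)) * bailey_kernel q m N j) -
      A * (q powi (j\<^sup>2 + (m - 1) * j) * y) * bailey_kernel q m N j =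
      q powi (j\<^sup>2 + (m - 1) * j) * lattice_kernel q m (Suc e) N j"
    unfolding lattice_kernel_def y_def[symmetric] partial_sums by (simp add: algebra_simps)
  finally show ?thesis .
qed

definition bailey_pair :: "'a::field \<Rightarrow> int \<Rightarrow> nat \<Rightarrow> (int \<Rightarrow> 'a) \<Rightarrow> (int \<Rightarrow> 'a) \<Rightarrow> bool" where
  "bailey_pair q m e \<alpha> \<beta> \<longleftrightarrow> (\<forall>n. \<beta> n = (\<Sum>j=-m-n..n. \<alpha> j * lattice_kernel q m e n j))"

lemma bailey_pair_cong:
  assumes "bailey_pair q m e \<alpha> \<beta>" "\<And>j. \<alpha> j = \<alpha>' j" "\<And>n. \<beta> n = \<beta>' n"
  shows "bailey_pair q m e \<alpha>' \<beta>'"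
  using assms by (simp add: bailey_pair_def)

lemma bailey_transform:
  assumes "bailey_pair q m e \<alpha> \<beta>"
    and "\<And>N j. (\<Sum>n=L..N. \<delta> N n * lattice_kernel q m e n j) = \<gamma> j * lattice_kernel q' m e' N j"
  shows "bailey_pair q' m e' (\<lambda>j. \<gamma> j * \<alpha> j) (\<lambda>N. \<Sum>n=L..N. \<delta> N n * \<beta> n)"
  unfolding bailey_pair_def
proof
  fix N
  have "\<beta> n = (\<Sum>j=-m-N..N. \<alpha> j * lattice_kernel q m e n j)" if "n \<le> N" for n
    using assms(1) that unfolding bailey_pair_def
    by (auto intro!: sum.mono_neutral_left simp: lattice_kernel_eq_0)
  then have "(\<Sum>n=L..N. \<delta> N n * \<beta> n) =
      (\<Sum>n=L..N. \<Sum>j=-m-N..N. \<alpha> j * (\<delta> N n * lattice_kernel q m e n j))"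
    by (simp add: sum_distrib_left mult.left_commute)
  also have "\<dots> = (\<Sum>j=-m-N..N. \<alpha> j * (\<Sum>n=L..N. \<delta> N n * lattice_kernel q m e n j))"
    unfolding sum_distrib_left by (rule sum.swap)
  finally show "(\<Sum>n=L..N. \<delta> N n * \<beta> n) = (\<Sum>j=-m-N..N. \<gamma> j * \<alpha> j * lattice_kernel q' m e' N j)"
    unfolding assms(2) by (simp add: mult_ac)
qed

lemma bailey_pair_chain:
  assumes "q \<noteq> 0" "not_root_of_unity q" "L \<le> - (m div 2)" "bailey_pair q m 0 \<alpha> \<beta>"
  shows "bailey_pair q m 0 (\<lambda>j. q powi (j\<^sup>2 + m * j) * \<alpha> j)
    (\<lambda>N. \<Sum>n=L..N. q powi (n\<^sup>2 + m * n) * rqfac q (N - n) * \<beta> n)"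
  using assms(4) by (rule bailey_transform) (simp add: bailey_kernel_chain_step[OF assms(1-3)])

lemma bailey_pair_lattice:
  assumes "q \<noteq> 0" "not_root_of_unity q" "L \<le> - (m div 2)" "bailey_pair q m e \<alpha> \<beta>"
  shows "bailey_pair q m (Suc e) (\<lambda>j. q powi (j\<^sup>2 + (m - 1) * j) * \<alpha> j)
    (\<lambda>N. \<Sum>n=L..N. q powi (n\<^sup>2 + (m - 1) * n) * rqfac q (N - n) * \<beta> n)"
  using assms(4) by (rule bailey_transform) (rule lattice_kernel_step[OF assms(1-3)])

lemma bailey_pair_base_change:
  fixes q :: "'a::field_char_0"
  assumes "q \<noteq> 0" "not_root_of_unity q" "L \<le> - (m div 2)" "bailey_pair (q\<^sup>2) m 0 \<alpha> \<beta>"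
  shows "bailey_pair q m 0 (\<lambda>j. q powi j / (1 + q powi (2 * j + m)) * \<alpha> j)
    (\<lambda>N. \<Sum>n=L..N. q powi n * qpoch_fin (-1) q (nat (m + 2 * n)) / 2 * rqfac (q\<^sup>2) (N - n) * \<beta> n)"
  using assms(4)
  by (rule bailey_transform) (simp only: lattice_kernel_0 bailey_kernel_base_change[OF assms(1-3)])

lemma bailey_pair_q_binomial:
  assumes "q \<noteq> 0" "not_root_of_unity q"
  shows "bailey_pair q m 0 (\<lambda>j. (-1) powi j * q powi choose_two j)
    (\<lambda>n. (-1) powi n * q powi choose_two n *
      (qpoch_fin (q powi (1 - n)) q (nat (m + 2 * n)) * rqfac q (m + 2 * n)))"
  unfolding bailey_pair_def
proof
  fix n
  show "(-1) powi n * q powi choose_two n *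
      (qpoch_fin (q powi (1 - n)) q (nat (m + 2 * n)) * rqfac q (m + 2 * n)) =
      (\<Sum>j=-m-n..n. (-1) powi j * q powi choose_two j * lattice_kernel q m 0 n j)"
    using q_binomial_theorem_shifted[OF assms one_neq_zero, of n "- m - n"]
    by (simp add: bailey_kernel_def algebra_simps)
qed

section \<open>Infinite products and the Jacobi triple product\<close>

lemma norm_power_less_1:
  fixes x :: "'a::real_normed_div_algebra"
  shows "norm x < 1 \<Longrightarrow> n > 0 \<Longrightarrow> norm (x ^ n) < 1"
  by (simp add: norm_power power_less_one_iff)

lemma convergent_prod_qpoch:
  fixes x p :: complex
  assumes "norm p < 1"
  shows "convergent_prod (\<lambda>j. 1 - x * p ^ j)"
proof (rule abs_convergent_prod_imp_convergent_prod)
  have "summable (\<lambda>j. norm x * norm p ^ j)"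
    using assms by (intro summable_mult summable_geometric) auto
  then show "abs_convergent_prod (\<lambda>j. 1 - x * p ^ j)"
    by (simp add: abs_convergent_prod_conv_summable norm_mult norm_power)
qed

lemma qpoch_fin_LIMSEQ:
  assumes "norm p < 1"
  shows "qpoch_fin x p \<longlonglongrightarrow> qpoch_inf x p"
  using convergent_prod_LIMSEQ[OF convergent_prod_qpoch[OF assms, of x]]
  unfolding qpoch_fin_def[abs_def] by (subst LIMSEQ_lessThan_iff_atMost) (simp add: qpoch_inf_def)

lemma qpoch_inf_split:
  assumes "norm p < 1"
  shows "qpoch_inf x p = qpoch_fin x p n * qpoch_inf (x * p ^ n) p"
proof (rule LIMSEQ_unique)
  show "(\<lambda>k. qpoch_fin x p (k + n)) \<longlonglongrightarrow> qpoch_inf x p"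
    by (rule LIMSEQ_ignore_initial_segment[OF qpoch_fin_LIMSEQ[OF assms]])
  show "(\<lambda>k. qpoch_fin x p (k + n)) \<longlonglongrightarrow> qpoch_fin x p n * qpoch_inf (x * p ^ n) p"
    unfolding add.commute[of _ n] qpoch_fin_add by (intro tendsto_intros qpoch_fin_LIMSEQ assms)
qed

lemma qpoch_inf_nonzero:
  assumes "norm p < 1" "\<And>i. x * p ^ i \<noteq> 1"
  shows "qpoch_inf x p \<noteq> 0"
  unfolding qpoch_inf_def
  by (rule prodinf_nonzero[OF convergent_prod_qpoch]) (use assms in \<open>auto dest: sym\<close>)

lemma qpoch_inf_self_nonzero:
  assumes "norm q < 1"
  shows "qpoch_inf q q \<noteq> 0"
  using assms not_root_of_unity_if_norm_less_1[OF assms]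
  by (intro qpoch_inf_nonzero) (auto simp: not_root_of_unity_def simp flip: power_Suc)

lemma qpoch_self:
  assumes "norm q < 1" "k \<ge> 0"
  shows "qpoch q q k = qpoch_fin q q (nat k)"
proof -
  have "qpoch_inf (q * q ^ nat k) q \<noteq> 0"
    using qpoch_inf_self_nonzero[OF assms(1)] qpoch_inf_split[OF assms(1), of q "nat k"] by auto
  then show ?thesis
    using qpoch_inf_split[OF assms(1), of q "nat k"] assms(2)
    by (simp add: qpoch_def power_int_nonneg_exp)
qed

lemma inverse_qpoch_self:
  assumes "norm q < 1" "k \<ge> 0"
  shows "1 / qpoch q q k = rqfac q k"
  using assms by (simp add: qpoch_self rqfac_def)

lemma qpoch_minus_self:
  assumes "norm q < 1" "q \<noteq> 0" "k \<ge> 0"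
  shows "qpoch (- q) q (k - 1) = qpoch_fin (-1) q (nat k) / 2"
proof -
  define n where "n = nat k"
  have k: "k = int n"
    using assms by (simp add: n_def)
  have "qpoch_inf (- (q ^ n)) q \<noteq> 0"
  proof (rule qpoch_inf_nonzero[OF assms(1)])
    fix i
    have "1 + q ^ (n + i) \<noteq> 0"
      using one_plus_power_int_nonzero[OF not_root_of_unity_if_norm_less_1[OF assms(1)],
          of "int (n + i)"]
      unfolding power_int_of_nat .
    then show "- (q ^ n) * q ^ i \<noteq> 1"
      by (metis add.right_inverse minus_minus mult_minus_left power_add)
  qed
  moreover have "- q * q powi (k - 1) = - (q ^ n)"
    using assms(2) by (simp add: k power_int_diff)
  moreover have "2 * qpoch_inf (- q) q = qpoch_fin (-1) q n * qpoch_inf (- (q ^ n)) q"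
    using qpoch_inf_split[OF assms(1), of "-1" 1] qpoch_inf_split[OF assms(1), of "-1" n]
    by (simp add: qpoch_fin_Suc)
  ultimately show ?thesis
    unfolding qpoch_def n_def[symmetric] by (simp add: field_simps)
qed

lemma qbinom_eq_qpoch_fin:
  assumes "norm q < 1" "q \<noteq> 0" "m \<ge> 0"
  shows "qbinom q (m + n) (m + 2 * n) =
      qpoch_fin (q powi (1 - n)) q (nat (m + 2 * n)) * rqfac q (m + 2 * n)"
proof -
  consider (negative) "m + 2 * n < 0" | (vanishing) "m + 2 * n \<ge> 0" "n > 0"
    | (nonzero) "m + 2 * n \<ge> 0" "n \<le> 0"
    by linarith
  then show ?thesis
  proof cases
    case negative
    then show ?thesis
      by (simp add: qbinom_def)
  next
    case vanishing
    have "q powi (1 - n) * q ^ nat (n - 1) = 1"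
      using assms(2) vanishing by (simp flip: power_int_nonneg_exp power_int_add)
    then have "qpoch_fin (q powi (1 - n)) q (nat (m + 2 * n)) = 0"
      by (rule qpoch_fin_eq_0) (use vanishing assms(3) in linarith)
    with vanishing show ?thesis
      by (simp add: qbinom_def)
  next
    case nonzero
    define a where "a = nat (- n)"
    have "nat (m + n) = a + nat (m + 2 * n)"
      using nonzero by (simp add: a_def)
    moreover have "q powi (1 - n) = q * q ^ a"
      using nonzero assms(2)
      by (simp add: a_def power_int_diff power_int_minus divide_inverse flip: power_int_nonneg_exp)
    ultimately have "qpoch_fin q q (nat (m + n)) =
        qpoch_fin q q a * qpoch_fin (q powi (1 - n)) q (nat (m + 2 * n))"
      by (simp only: qpoch_fin_add)
    moreover have "qpoch_fin q q a \<noteq> 0"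
      by (intro qpoch_fin_self_nonzero not_root_of_unity_if_norm_less_1 assms(1))
    ultimately show ?thesis
      using nonzero assms(1) by (simp add: qbinom_def qpoch_self rqfac_def a_def)
  qed
qed

lemma rqfac_LIMSEQ:
  assumes "norm q < 1"
  shows "(\<lambda>n. rqfac q (int n + k)) \<longlonglongrightarrow> 1 / qpoch_inf q q"
proof -
  have "filterlim (\<lambda>n. nat (int n + k)) at_top sequentially"
    unfolding filterlim_at_top eventually_sequentially
  proof
    fix Z
    show "\<exists>N. \<forall>n\<ge>N. Z \<le> nat (int n + k)"
      by (rule exI[of _ "Z + nat \<bar>k\<bar>"]) auto
  qed
  then have "(\<lambda>n. 1 / qpoch_fin q q (nat (int n + k))) \<longlonglongrightarrow> 1 / qpoch_inf q q"
    using assms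
    by (intro tendsto_divide tendsto_const qpoch_inf_self_nonzero
        filterlim_compose[OF qpoch_fin_LIMSEQ])
  moreover have "\<forall>\<^sub>F n in sequentially. 1 / qpoch_fin q q (nat (int n + k)) = rqfac q (int n + k)"
    using eventually_ge_at_top[of "nat \<bar>k\<bar>"] by eventually_elim (auto simp: rqfac_def)
  ultimately show ?thesis
    by (rule Lim_transform_eventually)
qed

lemma rqfac_bounded:
  fixes q :: complex
  assumes "norm q < 1"
  obtains C where "C > 0" "\<And>k. norm (rqfac q k) \<le> C"
proof -
  have "Bseq (\<lambda>n. rqfac q (int n + 0))"
    using rqfac_LIMSEQ[OF assms] convergent_def convergent_imp_Bseq by blast
  then obtain C where C: "C > 0" "\<And>n. norm (rqfac q (int n)) \<le> C"
    by (auto simp: Bseq_def)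
  have "norm (rqfac q k) \<le> C" for k
    using C(1) C(2)[of "nat k"] by (cases "k < 0") auto
  with C(1) show ?thesis
    by (rule that)
qed

lemma infsum_dominated_convergence:
  fixes f :: "nat \<Rightarrow> 'a \<Rightarrow> 'b::banach"
  assumes bound: "\<And>N x. x \<in> A \<Longrightarrow> norm (f N x) \<le> h x" and summable: "h summable_on A"
    and lim: "\<And>x. x \<in> A \<Longrightarrow> (\<lambda>N. f N x) \<longlonglongrightarrow> g x"
  shows "(\<lambda>N. infsum (f N) A) \<longlonglongrightarrow> infsum g A"
proof (rule swap_uniform_limit'[where S = UNIV and F = "finite_subsets_at_top A"])
  have "norm (g x) \<le> h x" if "x \<in> A" for x
    by (rule Lim_norm_ubound[OF _ lim[OF that]]) (use bound[OF that] in auto)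
  then have "(\<lambda>x. norm (g x)) summable_on A"
    by (rule Infinite_Sum.abs_summable_on_comparison_test'[OF summable])
  then have "g summable_on A"
    by (rule abs_summable_summable)
  then show "(sum g \<longlongrightarrow> infsum g A) (finite_subsets_at_top A)"
    by (rule infsum_tendsto)
  show "\<forall>\<^sub>F X in finite_subsets_at_top A. (\<lambda>N. \<Sum>x\<in>X. f N x) \<longlonglongrightarrow> (\<Sum>x\<in>X. g x)"
    by (rule eventually_finite_subsets_at_top_weakI) (auto intro!: tendsto_sum lim)
  show "uniform_limit UNIV (\<lambda>X N. \<Sum>x\<in>X. f N x) (\<lambda>N. infsum (f N) A) (finite_subsets_at_top A)"
    using Weierstrass_m_test_general[of A UNIV "\<lambda>x N. f N x" h] bound summable by simp
qed auto

lemma summable_on_theta_nat: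
  fixes \<rho> \<xi> :: real
  assumes "0 < \<rho>" "\<rho> < 1" "0 < \<xi>"
  shows "(\<lambda>n. \<rho> powi choose_two (int n) * \<xi> ^ n) summable_on UNIV"
proof -
  have "(\<lambda>n. \<rho> ^ n * \<xi>) \<longlonglongrightarrow> 0 * \<xi>"
    using assms by (intro tendsto_intros LIMSEQ_power_zero) auto
  then have "\<forall>\<^sub>F n in sequentially. \<rho> ^ n * \<xi> < 1 / 2"
    by (rule order_tendstoD) simp
  then obtain N where N: "\<And>n. n \<ge> N \<Longrightarrow> \<rho> ^ n * \<xi> < 1 / 2"
    by (auto simp: eventually_sequentially)
  have "summable (\<lambda>n. \<rho> powi choose_two (int n) * \<xi> ^ n)"
  proof (rule summable_ratio_test)
    fix n assume "N \<le> n"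
    have "choose_two (int (Suc n)) = choose_two (int n) + int n"
      using choose_two_add[of "int n" 1] by (simp add: add.commute)
    then have "norm (\<rho> powi choose_two (int (Suc n)) * \<xi> ^ Suc n) =
        \<rho> ^ n * \<xi> * norm (\<rho> powi choose_two (int n) * \<xi> ^ n)"
      using assms by (simp add: power_int_add abs_mult)
    also have "\<dots> \<le> 1 / 2 * norm (\<rho> powi choose_two (int n) * \<xi> ^ n)"
      using N[OF \<open>N \<le> n\<close>] by (intro mult_right_mono) auto
    finally show "norm (\<rho> powi choose_two (int (Suc n)) * \<xi> ^ Suc n) \<le>
        1 / 2 * norm (\<rho> powi choose_two (int n) * \<xi> ^ n)" .
  qed simp
  then show ?thesis
    using assms by (subst summable_on_UNIV_nonneg_real_iff) auto
qed

lemma summable_on_theta: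
  fixes \<rho> \<zeta> :: real
  assumes "0 < \<rho>" "\<rho> < 1" "0 < \<zeta>"
  shows "(\<lambda>j. \<rho> powi choose_two j * \<zeta> powi j) summable_on UNIV"
proof -
  let ?f = "\<lambda>j. \<rho> powi choose_two j * \<zeta> powi j"
  have "?f summable_on {0..} \<longleftrightarrow> (\<lambda>n. \<rho> powi choose_two (int n) * \<zeta> ^ n) summable_on UNIV"
    by (rule summable_on_reindex_bij_witness[of _ int nat]) (simp_all add: power_int_nonneg_exp)
  then have "?f summable_on {0..}"
    using summable_on_theta_nat[OF assms] by (rule iffD2)
  moreover have "?f summable_on {..0} \<longleftrightarrow>
      (\<lambda>n. \<rho> powi choose_two (int n) * (\<rho> / \<zeta>) ^ n) summable_on UNIV"
  proof (rule summable_on_reindex_bij_witness[of _ "\<lambda>n. - int n" "\<lambda>j. nat (- j)"])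
    fix j :: int
    assume "j \<in> {..0}"
    then obtain n where "j = - int n"
      by (metis nonpos_int_cases atMost_iff)
    then show "\<rho> powi choose_two (int (nat (- j))) * (\<rho> / \<zeta>) ^ nat (- j) = ?f j"
      using assms
      by (simp add: choose_two_minus power_int_add power_int_minus power_divide inverse_eq_divide)
  qed simp_all
  then have "?f summable_on {..0}"
    using assms by (auto intro!: summable_on_theta_nat)
  ultimately have "?f summable_on ({0..} \<union> {..0})"
    by (rule summable_on_union)
  moreover have "{0..} \<union> {..0} = (UNIV :: int set)"
    by auto
  ultimately show ?thesis
    by simp
qed

lemma qpoch_fin_reverse:
  fixes q y :: "'a::field"
  assumes "q \<noteq> 0" "y \<noteq> 0"
  shows "qpoch_fin (y * q powi (- int n)) q n =
      (- y) ^ n * q powi (- choose_two (int n + 1)) * qpoch_fin (q / y) q n"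
proof (induction n)
  case (Suc n)
  have inverse: "q powi (- int (Suc n)) = inverse (q ^ Suc n)"
    by (simp only: power_int_minus power_int_of_nat)
  then have "y * q powi (- int (Suc n)) * (q / y * q ^ n) = 1"
    using assms by (simp add: field_simps)
  then have factor: "1 - y * q powi (- int (Suc n)) =
      - y * q powi (- int (Suc n)) * (1 - q / y * q ^ n)"
    by (simp add: algebra_simps)
  have "q powi (- int (Suc n)) * q = q powi (- int n)"
    unfolding inverse using assms(1) by (simp add: power_int_minus)
  then have "qpoch_fin (y * q powi (- int (Suc n))) q (Suc n) =
      (1 - y * q powi (- int (Suc n))) * qpoch_fin (y * q powi (- int n)) q n"
    using qpoch_fin_add[of "y * q powi (- int (Suc n))" q 1 n]
    by (simp add: qpoch_fin_Suc mult.assoc)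
  also have "\<dots> = (- y) ^ Suc n * (q powi (- int (Suc n)) * q powi (- choose_two (int n + 1))) *
      qpoch_fin (q / y) q (Suc n)"
    unfolding Suc.IH factor by (simp add: qpoch_fin_Suc mult_ac)
  also have "q powi (- int (Suc n)) * q powi (- choose_two (int n + 1)) =
      q powi (- choose_two (int (Suc n) + 1))"
    using assms(1) choose_two_add[of "int n + 1" 1] by (simp add: algebra_simps flip: power_int_add)
  finally show ?case .
qed simp

definition theta_term :: "'a::field \<Rightarrow> 'a \<Rightarrow> int \<Rightarrow> 'a" where
  "theta_term p z j = (-1) powi j * p powi choose_two j * z powi j"

lemma theta_term_add:
  assumes "p \<noteq> 0" "z \<noteq> 0"
  shows "theta_term p z (j + k) = theta_term p z k * theta_term p (z * p powi k) j"
proof -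
  have "p powi choose_two (j + k) = p powi choose_two j * p powi choose_two k * (p powi k) powi j"
    using assms(1) by (simp add: choose_two_add power_int_add power_int_mult mult.commute[of j k])
  then show ?thesis
    using assms(2) by (simp add: theta_term_def power_int_add power_int_mult_distrib)
qed

lemma finite_jacobi_triple_product:
  assumes "p \<noteq> 0" "not_root_of_unity p" "z \<noteq> 0"
  shows "(\<Sum>j=-int n..int n. theta_term p z j * (rqfac p (int n - j) * rqfac p (int n + j))) =
    qpoch_fin z p n * qpoch_fin (p / z) p n * rqfac p (2 * int n)"
proof -
  have nat: "nat (int n - - int n) = n + n"
    by simp
  have "(\<Sum>j=-int n..int n. theta_term p z j * (rqfac p (int n - j) * rqfac p (int n + j))) =
      (-1) ^ n * p powi choose_two (int n) * z ^ n *
        (qpoch_fin (p powi (1 - int n) / z) p (n + n) * rqfac p (2 * int n))"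
    using q_binomial_theorem_shifted[OF assms, of "int n" "- int n"]
    unfolding nat by (simp add: theta_term_def add.commute)
  also have "p powi (1 - int n) / z = p / z * p powi (- int n)"
    using assms(1) by (simp add: power_int_diff power_int_minus divide_inverse)
  also have "qpoch_fin (p / z * p powi (- int n)) p (n + n) =
      qpoch_fin (p / z * p powi (- int n)) p n * qpoch_fin (p / z) p n"
    unfolding qpoch_fin_add using assms(1) by (simp add: power_int_minus mult.assoc)
  also have "qpoch_fin (p / z * p powi (- int n)) p n =
      (- (p / z)) ^ n * p powi (- choose_two (int n + 1)) * qpoch_fin z p n"
    using qpoch_fin_reverse[of p "p / z" n] assms(1,3) by simp
  also have "(-1) ^ n * p powi choose_two (int n) * z ^ n *
      ((- (p / z)) ^ n * p powi (- choose_two (int n + 1)) *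
      qpoch_fin z p n * qpoch_fin (p / z) p n * rqfac p (2 * int n)) =
      (-1) ^ n * z ^ n * (- (p / z)) ^ n *
      (p powi choose_two (int n) * p powi (- choose_two (int n + 1))) *
      (qpoch_fin z p n * qpoch_fin (p / z) p n * rqfac p (2 * int n))"
    by (simp only: mult_ac)
  also have "p powi choose_two (int n) * p powi (- choose_two (int n + 1)) = p powi (- int n)"
    using assms(1) choose_two_add[of "int n" 1] by (simp flip: power_int_add)
  also have "(-1) ^ n * z ^ n * (- (p / z)) ^ n * p powi (- int n) = 1"
    using assms(1,3) by (simp add: power_int_minus flip: power_mult_distrib)
  finally show ?thesis
    by simp
qed

definition theta_prod :: "complex \<Rightarrow> complex \<Rightarrow> complex" where
  "theta_prod p z = qpoch_infs [p, z, p / z] p"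

lemma theta_term_abs_summable:
  fixes p z :: complex
  assumes "p \<noteq> 0" "norm p < 1" "z \<noteq> 0"
  shows "(\<lambda>j. norm (theta_term p z j)) summable_on UNIV"
  using summable_on_theta[of "norm p" "norm z"] assms
  by (simp add: theta_term_def norm_mult norm_power_int)

lemma finite_triple_product_LIMSEQ:
  assumes "norm p < 1"
  shows "(\<lambda>n. qpoch_fin z p n * qpoch_fin (p / z) p n * rqfac p (2 * int n)) \<longlonglongrightarrow>
    qpoch_inf z p * qpoch_inf (p / z) p * (1 / qpoch_inf p p)"
proof -
  have "(\<lambda>n. rqfac p (2 * int n)) \<longlonglongrightarrow> 1 / qpoch_inf p p"
    using LIMSEQ_subseq_LIMSEQ[OF rqfac_LIMSEQ[OF assms, of 0], of "\<lambda>n. 2 * n"]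
    by (auto simp: strict_mono_def o_def)
  then show ?thesis
    by (intro tendsto_mult qpoch_fin_LIMSEQ assms)
qed

theorem jacobi_triple_product:
  assumes "p \<noteq> 0" "norm p < 1" "z \<noteq> 0"
  shows "(theta_term p z has_sum theta_prod p z) UNIV"
proof -
  define f where "f = (\<lambda>n j. theta_term p z j * (rqfac p (int n - j) * rqfac p (int n + j)))"
  obtain C where C: "C > 0" "\<And>k. norm (rqfac p k) \<le> C"
    using rqfac_bounded[OF assms(2)] by blast
  have lim: "(\<lambda>n. infsum (f n) UNIV) \<longlonglongrightarrow>
      (\<Sum>\<^sub>\<infinity>j. theta_term p z j * (1 / qpoch_inf p p * (1 / qpoch_inf p p)))"
  proof (rule infsum_dominated_convergence)
    show "norm (f n j) \<le> norm (theta_term p z j) * (C * C)" for n j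
      unfolding f_def norm_mult using C by (intro mult_left_mono mult_mono) auto
    show "(\<lambda>j. norm (theta_term p z j) * (C * C)) summable_on UNIV"
      by (intro summable_on_cmult_left theta_term_abs_summable assms)
    show "(\<lambda>n. f n j) \<longlonglongrightarrow> theta_term p z j * (1 / qpoch_inf p p * (1 / qpoch_inf p p))" for j
      unfolding f_def using rqfac_LIMSEQ[OF assms(2), of j] rqfac_LIMSEQ[OF assms(2), of "- j"]
      by (intro tendsto_intros) auto
  qed
  have partial: "infsum (f n) UNIV =
      qpoch_fin z p n * qpoch_fin (p / z) p n * rqfac p (2 * int n)" for n
  proof -
    have "infsum (f n) UNIV = infsum (f n) {-int n..int n}"
      by (rule infsum_cong_neutral) (auto simp: f_def)
    then show ?thesis
      using finite_jacobi_triple_product[OF assms(1) not_root_of_unity_if_norm_less_1[OF assms(2)]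
          assms(3), of n]
      by (simp add: f_def)
  qed
  have "(\<Sum>\<^sub>\<infinity>j. theta_term p z j * (1 / qpoch_inf p p * (1 / qpoch_inf p p))) =
      qpoch_inf z p * qpoch_inf (p / z) p * (1 / qpoch_inf p p)"
    using lim finite_triple_product_LIMSEQ[OF assms(2), of z] unfolding partial
    by (rule LIMSEQ_unique)
  then have "infsum (theta_term p z) UNIV = theta_prod p z"
    using qpoch_inf_self_nonzero[OF assms(2)] unfolding infsum_cmult_left'
    by (simp add: theta_prod_def qpoch_infs_def field_simps)
  moreover have "theta_term p z summable_on UNIV"
    by (rule abs_summable_summable[OF theta_term_abs_summable[OF assms]])
  ultimately show ?thesis
    by (simp add: has_sum_iff)
qed

lemma theta_prod_quasiperiodic:
  assumes "p \<noteq> 0" "norm p < 1" "z \<noteq> 0"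
  shows "theta_prod p z = theta_term p z k * theta_prod p (z * p powi k)"
proof (rule has_sum_unique)
  show "((\<lambda>j. theta_term p z (j + k)) has_sum theta_prod p z) UNIV"
    using jacobi_triple_product[OF assms]
    by (subst has_sum_reindex_bij_witness[of _ "\<lambda>j. j - k" "\<lambda>j. j + k" UNIV "theta_term p z"]) auto
  show "((\<lambda>j. theta_term p z (j + k)) has_sum theta_term p z k * theta_prod p (z * p powi k)) UNIV"
    unfolding theta_term_add[OF assms(1,3)]
    using assms by (intro has_sum_cmult_right jacobi_triple_product) auto
qed

lemma theta_prod_power_int:
  assumes "q \<noteq> 0"
  shows "theta_prod (q ^ n) (q powi a) = qpoch_infs [q ^ n, q powi a, q powi (int n - a)] (q ^ n)"
  unfolding theta_prod_def using assms by (simp add: power_int_diff)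

lemma theta_prod_power_int_quasiperiodic:
  assumes "q \<noteq> 0" "norm q < 1" "n > 0"
  shows "theta_prod (q ^ (2 * n)) (q powi a) =
    (-1) powi k * q powi (int n * (k\<^sup>2 - k) + a * k) *
    theta_prod (q ^ (2 * n)) (q powi (a + int (2 * n) * k))"
proof -
  have "norm (q ^ (2 * n)) < 1"
    using assms(2,3) by (intro norm_power_less_1) auto
  then have "theta_prod (q ^ (2 * n)) (q powi a) = theta_term (q ^ (2 * n)) (q powi a) k *
      theta_prod (q ^ (2 * n)) (q powi a * (q ^ (2 * n)) powi k)"
    using assms(1) by (intro theta_prod_quasiperiodic) auto
  also have "q powi a * (q ^ (2 * n)) powi k = q powi (a + int (2 * n) * k)"
    using assms(1) by (simp only: power_int_add power_int_mult power_int_of_nat simp_thms)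
  also have "theta_term (q ^ (2 * n)) (q powi a) k =
      (-1) powi k * q powi (int n * (k\<^sup>2 - k) + a * k)"
    unfolding theta_term_def power_int_choose_two using assms(1)
    by (simp add: power_int_add power_int_mult)
  finally show ?thesis .
qed

section \<open>The multisum as a Bailey chain\<close>

definition innermost_weight :: "complex \<Rightarrow> int \<Rightarrow> int \<Rightarrow> complex" where
  "innermost_weight q m n =
    q powi n\<^sup>2 * (qpoch (- q) q (m + 2 * n - 1) * (-1) powi n * qbinom (q\<^sup>2) (m + n) (m + 2 * n))"

definition chain_numerator :: "'a::field \<Rightarrow> int \<Rightarrow> nat \<Rightarrow> nat \<Rightarrow> int \<Rightarrow> 'a" where
  "chain_numerator q m k e j = (-1) powi j * q powi (int (Suc k) * j\<^sup>2 + (int k * m - int e) * j)"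

definition chain_alpha :: "'a::field \<Rightarrow> int \<Rightarrow> nat \<Rightarrow> nat \<Rightarrow> int \<Rightarrow> 'a" where
  "chain_alpha q m k e j = chain_numerator q m k e j / (1 + q powi (2 * j + m))"

lemma chain_alpha_Suc:
  assumes "q \<noteq> 0"
  shows "q powi (j\<^sup>2 + m * j) * chain_alpha q m k e j = chain_alpha q m (Suc k) e j"
    and "q powi (j\<^sup>2 + (m - 1) * j) * chain_alpha q m k e j = chain_alpha q m (Suc k) (Suc e) j"
proof -
  have exponents: "int (Suc (Suc k)) * j\<^sup>2 + (int (Suc k) * m - int e) * j =
      j\<^sup>2 + m * j + (int (Suc k) * j\<^sup>2 + (int k * m - int e) * j)"
    "int (Suc (Suc k)) * j\<^sup>2 + (int (Suc k) * m - int (Suc e)) * j =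
      j\<^sup>2 + (m - 1) * j + (int (Suc k) * j\<^sup>2 + (int k * m - int e) * j)"
    by (simp_all add: algebra_simps)
  show "q powi (j\<^sup>2 + m * j) * chain_alpha q m k e j = chain_alpha q m (Suc k) e j"
    and "q powi (j\<^sup>2 + (m - 1) * j) * chain_alpha q m k e j = chain_alpha q m (Suc k) (Suc e) j"
    unfolding chain_alpha_def chain_numerator_def exponents using assms
    by (simp_all add: power_int_add)
qed

lemma innermost_bailey_pair:
  assumes "q \<noteq> 0" "norm q < 1" "m \<ge> 0"
  shows "bailey_pair q m 0 (chain_alpha q m 0 0)
    (\<lambda>N. \<Sum>n=-(m div 2)..N. rqfac (q\<^sup>2) (N - n) * innermost_weight q m n)"
proof -
  have generic: "not_root_of_unity q" "not_root_of_unity (q\<^sup>2)"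
    using assms(2) by (auto intro: not_root_of_unity_if_norm_less_1 not_root_of_unity_power)
  have norm_square: "norm (q\<^sup>2) < 1"
    using assms(2) by (simp add: norm_power power_less_one_iff)
  have square: "(q\<^sup>2) powi choose_two j = q powi (j\<^sup>2 - j)" for j
    using power_int_choose_two[of q 1 j] by simp
  have "bailey_pair (q\<^sup>2) m 0 (\<lambda>j. (-1) powi j * (q\<^sup>2) powi choose_two j)
      (\<lambda>n. (-1) powi n * (q\<^sup>2) powi choose_two n * qbinom (q\<^sup>2) (m + n) (m + 2 * n))"
    using bailey_pair_q_binomial[OF _ generic(2), of m] assms norm_square
    by (simp add: qbinom_eq_qpoch_fin)
  from bailey_pair_base_change[OF assms(1) generic(1) order_refl this]
  show ?thesis
  proof (rule bailey_pair_cong)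
    show "q powi j / (1 + q powi (2 * j + m)) * ((-1) powi j * (q\<^sup>2) powi choose_two j) =
        chain_alpha q m 0 0 j" for j
      using assms(1) unfolding square chain_alpha_def chain_numerator_def
      by (simp add: power_int_diff)
    fix N
    show "(\<Sum>n=-(m div 2)..N. q powi n * qpoch_fin (-1) q (nat (m + 2 * n)) / 2 *
        rqfac (q\<^sup>2) (N - n) *
        ((-1) powi n * (q\<^sup>2) powi choose_two n * qbinom (q\<^sup>2) (m + n) (m + 2 * n))) =
      (\<Sum>n=-(m div 2)..N. rqfac (q\<^sup>2) (N - n) * innermost_weight q m n)"
    proof (rule sum.cong)
      fix n assume "n \<in> {- (m div 2)..N}"
      then have "m + 2 * n \<ge> 0"
        by auto
      then have "qpoch (- q) q (m + 2 * n - 1) = qpoch_fin (-1) q (nat (m + 2 * n)) / 2"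
        by (rule qpoch_minus_self[OF assms(2,1)])
      moreover have "q powi n\<^sup>2 = q powi n * (q\<^sup>2) powi choose_two n"
        unfolding square using assms(1) by (simp flip: power_int_add)
      ultimately show "q powi n * qpoch_fin (-1) q (nat (m + 2 * n)) / 2 * rqfac (q\<^sup>2) (N - n) *
          ((-1) powi n * (q\<^sup>2) powi choose_two n * qbinom (q\<^sup>2) (m + n) (m + 2 * n)) =
        rqfac (q\<^sup>2) (N - n) * innermost_weight q m n"
        by (simp add: innermost_weight_def)
    qed simp
  qed
qed

definition chain_tuples :: "nat \<Rightarrow> nat \<Rightarrow> nat \<Rightarrow> int \<Rightarrow> (nat \<Rightarrow> int) set" where
  "chain_tuples m r a N = {s \<in> {a..r} \<rightarrow>\<^sub>E UNIV. (\<forall>j\<in>{a..<r}. s (Suc j) \<le> s j) \<and>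
      - (int m div 2) \<le> s r \<and> s a \<le> N}"

lemma floor_half_nat: "\<lfloor>real m / 2\<rfloor> = int m div 2"
  using floor_divide_of_int_eq[of "int m" 2] by simp

lemma chain_tuples_eq_index_tuples: "chain_tuples m r 1 N = {s \<in> index_tuples m r. s 1 \<le> N}"
  unfolding chain_tuples_def index_tuples_def floor_half_nat by auto

lemma chain_tuples_last_le_first:
  assumes "s \<in> chain_tuples m r a N" "a \<le> r"
  shows "s r \<le> s a"
  using assms(2)
proof (induction rule: inc_induct)
  case (step n)
  then have "s (Suc n) \<le> s n"
    using assms(1) by (auto simp: chain_tuples_def)
  with step show ?case
    by simp
qed auto

lemma fun_upd_in_chain_tuples_iff:
  assumes "a < r" "s a = undefined"
  shows "s(a := n) \<in> chain_tuples m r a N \<longleftrightarrow> n \<le> N \<and> s \<in> chain_tuples m r (Suc a) n"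
proof -
  have "{a..<r} = insert a {Suc a..<r}"
    using assms by auto
  then have "(\<forall>j\<in>{a..<r}. (s(a := n)) (Suc j) \<le> (s(a := n)) j) \<longleftrightarrow>
     s (Suc a) \<le> n \<and> (\<forall>j\<in>{Suc a..<r}. s (Suc j) \<le> s j)"
    by auto
  moreover have "s(a := n) \<in> {a..r} \<rightarrow>\<^sub>E UNIV \<longleftrightarrow> s \<in> {Suc a..r} \<rightarrow>\<^sub>E UNIV"
    using assms by (auto simp: PiE_def extensional_def le_less_Suc_eq Suc_le_eq)
  ultimately show ?thesis
    using assms unfolding chain_tuples_def by auto
qed

lemma bij_betw_chain_tuples_Suc:
  assumes "a < r"
  shows "bij_betw (\<lambda>(n, s). s(a := n)) (SIGMA n:{-(int m div 2)..N}. chain_tuples m r (Suc a) n)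
    (chain_tuples m r a N)"
proof (rule bij_betw_byWitness[where f' = "\<lambda>s. (s a, s(a := undefined))"])
  have undefined: "s a = undefined" if "s \<in> chain_tuples m r (Suc a) n" for s n
    using that by (auto simp: chain_tuples_def PiE_def extensional_def)
  let ?S = "SIGMA n:{-(int m div 2)..N}. chain_tuples m r (Suc a) n"
  show "\<forall>x\<in>?S. (\<lambda>s. (s a, s(a := undefined))) ((\<lambda>(n, s). s(a := n)) x) = x"
    by (auto simp: fun_eq_iff intro!: undefined[symmetric])
  show "\<forall>s\<in>chain_tuples m r a N. (\<lambda>(n, s). s(a := n)) (s a, s(a := undefined)) = s"
    by auto
  show "(\<lambda>(n, s). s(a := n)) ` ?S \<subseteq> chain_tuples m r a N"
    using undefined fun_upd_in_chain_tuples_iff[OF assms] by auto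
  show "(\<lambda>s. (s a, s(a := undefined))) ` chain_tuples m r a N \<subseteq> ?S"
  proof (rule image_subsetI)
    fix s assume s: "s \<in> chain_tuples m r a N"
    then have "(s(a := undefined))(a := s a) \<in> chain_tuples m r a N"
      by simp
    then have "s a \<le> N" "s(a := undefined) \<in> chain_tuples m r (Suc a) (s a)"
      using fun_upd_in_chain_tuples_iff[OF assms, of "s(a := undefined)" "s a"] by auto
    moreover have "- (int m div 2) \<le> s a"
      using chain_tuples_last_le_first[OF s] assms s by (simp add: chain_tuples_def)
    ultimately show "(s a, s(a := undefined)) \<in> ?S"
      by simp
  qed
qed

lemma finite_chain_tuples: "a \<le> r \<Longrightarrow> finite (chain_tuples m r a N)"
proof (induction arbitrary: N rule: inc_induct)
  case base
  have "chain_tuples m r r N \<subseteq> {r..r} \<rightarrow>\<^sub>E {-(int m div 2)..N}"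
    by (auto simp: chain_tuples_def PiE_def)
  then show ?case
    by (rule finite_subset) (simp add: finite_PiE)
next
  case (step a)
  then show ?case
    using bij_betw_finite[OF bij_betw_chain_tuples_Suc[OF step.hyps(2), of m N]] by simp
qed

lemma sum_chain_tuples_last:
  "(\<Sum>s\<in>chain_tuples m r r N. f (s r)) = (\<Sum>n=-(int m div 2)..N. f n)"
  by (rule sum.reindex_bij_witness[of _ "\<lambda>n. (\<lambda>_. undefined)(r := n)" "\<lambda>s. s r"])
     (auto simp: chain_tuples_def PiE_def extensional_def fun_eq_iff)

lemma sum_chain_tuples_Suc:
  assumes "a < r"
  shows "(\<Sum>s\<in>chain_tuples m r a N. f s) =
    (\<Sum>n=-(int m div 2)..N. \<Sum>s\<in>chain_tuples m r (Suc a) n. f (s(a := n)))"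
  unfolding sum.reindex_bij_betw[OF bij_betw_chain_tuples_Suc[OF assms], symmetric]
  using assms by (subst sum.Sigma) (auto simp: case_prod_unfold finite_chain_tuples)

definition link :: "complex \<Rightarrow> nat \<Rightarrow> nat \<Rightarrow> int \<Rightarrow> complex" where
  "link q r j d = (if Suc j = r then rqfac (q\<^sup>2) d else rqfac q d)"

definition chain_weight :: "complex \<Rightarrow> nat \<Rightarrow> nat \<Rightarrow> nat \<Rightarrow> nat \<Rightarrow> (nat \<Rightarrow> int) \<Rightarrow> complex" where
  "chain_weight q m r i a s =
    (\<Prod>j=a..<r. q powi ((s j)\<^sup>2 + (int m - of_bool (j \<le> i)) * s j) * link q r j (s j - s (Suc j))) *
    innermost_weight q (int m) (s r)"

text \<open>The sum runs over \<open>s\<^sub>b\<^sub>+\<^sub>1 \<ge> \<dots> \<ge> s\<^sub>r\<close> with \<open>s\<^sub>b = N\<close> prescribed.\<close>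

definition chain_sum :: "complex \<Rightarrow> nat \<Rightarrow> nat \<Rightarrow> nat \<Rightarrow> nat \<Rightarrow> int \<Rightarrow> complex" where
  "chain_sum q m r i b N =
    (\<Sum>s\<in>chain_tuples m r (Suc b) N. link q r b (N - s (Suc b)) * chain_weight q m r i (Suc b) s)"

lemma chain_sum_last:
  assumes "Suc b = r"
  shows "chain_sum q m r i b N =
    (\<Sum>n=-(int m div 2)..N. rqfac (q\<^sup>2) (N - n) * innermost_weight q (int m) n)"
proof -
  have "chain_sum q m r i b N =
      (\<Sum>s\<in>chain_tuples m r r N. rqfac (q\<^sup>2) (N - s r) * innermost_weight q (int m) (s r))"
    using assms by (simp add: chain_sum_def chain_weight_def link_def)
  also have "\<dots> = (\<Sum>n=-(int m div 2)..N. rqfac (q\<^sup>2) (N - n) * innermost_weight q (int m) n)"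
    by (rule sum_chain_tuples_last)
  finally show ?thesis .
qed

lemma chain_sum_Suc:
  assumes "Suc b < r"
  shows "chain_sum q m r i b N = (\<Sum>n=-(int m div 2)..N.
    q powi (n\<^sup>2 + (int m - of_bool (Suc b \<le> i)) * n) * rqfac q (N - n) *
      chain_sum q m r i (Suc b) n)"
proof -
  have "{Suc b..<r} = insert (Suc b) {Suc (Suc b)..<r}"
    using assms by auto
  then have "chain_weight q m r i (Suc b) (s(Suc b := n)) =
      q powi (n\<^sup>2 + (int m - of_bool (Suc b \<le> i)) * n) *
      (link q r (Suc b) (n - s (Suc (Suc b))) * chain_weight q m r i (Suc (Suc b)) s)" for n s
    using assms unfolding chain_weight_def by simp
  moreover have "link q r b d = rqfac q d" for d
    using assms by (simp add: link_def)
  ultimately show ?thesis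
    unfolding chain_sum_def sum_chain_tuples_Suc[OF assms] by (simp add: sum_distrib_left mult_ac)
qed

lemma bailey_pair_chain_sum:
  assumes "q \<noteq> 0" "norm q < 1" "i < r" "b < r"
  shows "bailey_pair q (int m) (i - b)
    (chain_alpha q (int m) (r - Suc b) (i - b)) (chain_sum q m r i b)"
proof -
  have generic: "not_root_of_unity q"
    using assms(2) by (rule not_root_of_unity_if_norm_less_1)
  have "b \<le> r - 1"
    using assms(4) by simp
  then show ?thesis
  proof (induction rule: inc_induct)
    case base
    have "bailey_pair q (int m) 0 (chain_alpha q (int m) 0 0) (chain_sum q m r i (r - 1))"
      using assms(3)
      by (intro bailey_pair_cong[OF innermost_bailey_pair[OF assms(1,2)]])
         (simp_all add: chain_sum_last)
    with assms(3) show ?case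
      by simp
  next
    case (step b)
    then have less: "Suc b < r" and remaining: "r - Suc b = Suc (r - Suc (Suc b))"
      by auto
    show ?case
    proof (cases "b < i")
      case True
      then have index: "i - b = Suc (i - Suc b)"
        by simp
      show ?thesis
        unfolding remaining index
        by (rule bailey_pair_cong[OF bailey_pair_lattice[OF assms(1) generic order_refl step.IH]])
           (use True in \<open>simp_all add: chain_alpha_Suc[OF assms(1)] chain_sum_Suc[OF less]\<close>)
    next
      case False
      then have index: "i - b = 0" "i - Suc b = 0"
        by simp_all
      show ?thesis
        unfolding remaining index(1)
        by (rule bailey_pair_cong[OF bailey_pair_chain[OF assms(1) generic order_refl
                step.IH[unfolded index(2)]]])
           (use False in \<open>simp_all add: chain_alpha_Suc[OF assms(1)] chain_sum_Suc[OF less]\<close>)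
    qed
  qed
qed

lemma power_int_sum:
  fixes x :: "'a::field"
  assumes "x \<noteq> 0"
  shows "x powi (\<Sum>j\<in>A. f j) = (\<Prod>j\<in>A. x powi f j)"
  using assms by (induction A rule: infinite_finite_induct) (auto simp: power_int_add)

lemma summand_eq_chain_weight:
  assumes "q \<noteq> 0" "norm q < 1" "r \<ge> 2" "i \<le> r - 1" "s \<in> index_tuples m r"
  shows "q powi ((\<Sum>j=1..r. (s j)\<^sup>2) + int m * (\<Sum>j=1..r-1. s j) - (\<Sum>j=1..i. s j))
             * qpoch (- q) q (int m + 2 * s r - 1)
             / ((\<Prod>j=1..r-2. qpoch q q (s j - s (Suc j)))
                * qpoch (q\<^sup>2) (q\<^sup>2) (s (r - 1) - s r))
             * (-1) powi (s r)
             * qbinom (q\<^sup>2) (int m + s r) (int m + 2 * s r) = chain_weight q m r i 1 s"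
proof -
  have descending: "0 \<le> s j - s (Suc j)" if "j \<in> {1..<r}" for j
    using assms(5) that by (auto simp: index_tuples_def)
  have intervals: "{1..r} = insert r {1..<r}" "{1..r-1} = {1..<r}"
    using assms(3) by auto
  have "(\<Sum>j=1..i. s j) = (\<Sum>j=1..<r. of_bool (j \<le> i) * s j)"
    by (rule sum.mono_neutral_cong_left) (use assms(3,4) in auto)
  then have "(\<Sum>j=1..r. (s j)\<^sup>2) + int m * (\<Sum>j=1..r-1. s j) - (\<Sum>j=1..i. s j) =
      (s r)\<^sup>2 + (\<Sum>j=1..<r. (s j)\<^sup>2 + (int m - of_bool (j \<le> i)) * s j)"
    unfolding intervals by (simp add: sum_distrib_left sum.distrib sum_subtractf left_diff_distrib)
  then have powers: "q powi ((\<Sum>j=1..r. (s j)\<^sup>2) + int m * (\<Sum>j=1..r-1. s j) - (\<Sum>j=1..i. s j)) =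
      q powi (s r)\<^sup>2 * (\<Prod>j=1..<r. q powi ((s j)\<^sup>2 + (int m - of_bool (j \<le> i)) * s j))"
    using assms(1) by (simp only: power_int_add power_int_sum simp_thms)
  obtain k where r: "r = Suc (Suc k)"
    using assms(3) by (metis add_2_eq_Suc le_Suc_ex)
  have "(\<Prod>j=1..<r. link q r j (s j - s (Suc j))) =
      (\<Prod>j=1..k. rqfac q (s j - s (Suc j))) * rqfac (q\<^sup>2) (s (Suc k) - s r)"
    unfolding r by (simp add: link_def atLeastLessThanSuc_atLeastAtMost[symmetric])
  also have "\<dots> = 1 / ((\<Prod>j=1..k. qpoch q q (s j - s (Suc j))) * qpoch (q\<^sup>2) (q\<^sup>2) (s (Suc k) - s r))"
    using descending norm_power_less_1[OF assms(2), of 2] assms(2)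
    by (simp add: inverse_qpoch_self[symmetric] prod_dividef r)
  finally have links: "(\<Prod>j=1..<r. link q r j (s j - s (Suc j))) =
      1 / ((\<Prod>j=1..r-2. qpoch q q (s j - s (Suc j))) * qpoch (q\<^sup>2) (q\<^sup>2) (s (r - 1) - s r))"
    by (simp add: r)
  show ?thesis
    unfolding chain_weight_def prod.distrib links powers innermost_weight_def by (simp add: mult_ac)
qed

section \<open>Passage to the limit\<close>

lemma bailey_kernel_LIMSEQ:
  fixes q :: complex
  assumes "norm q < 1"
  shows "(\<lambda>N. bailey_kernel q m (int N) j) \<longlonglongrightarrow> 1 / (qpoch_inf q q)\<^sup>2"
proof -
  have "(\<lambda>N. bailey_kernel q m (int N) j) \<longlonglongrightarrow> 1 / qpoch_inf q q * (1 / qpoch_inf q q)"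
    unfolding bailey_kernel_def
    using rqfac_LIMSEQ[OF assms, of "- j"] rqfac_LIMSEQ[OF assms, of "j + m"]
    by (intro tendsto_mult) (simp_all add: add.assoc)
  then show ?thesis
    by (simp add: power2_eq_square)
qed

lemma lattice_kernel_LIMSEQ:
  fixes q :: complex
  assumes "q \<noteq> 0" "norm q < 1"
  shows "(\<lambda>N. lattice_kernel q m e (int N) j) \<longlonglongrightarrow>
    (\<Sum>k\<le>e. (q powi (2 * j + m)) ^ k) / (qpoch_inf q q)\<^sup>2"
proof -
  have "(\<lambda>N. q powi (j + m) * q ^ N) \<longlonglongrightarrow> q powi (j + m) * 0"
    using assms(2) by (intro tendsto_intros LIMSEQ_power_zero)
  moreover have "q powi (j + m) * q ^ N = q powi (int N + j + m)" for N
    using assms(1) by (simp add: power_int_add)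
  ultimately have "(\<lambda>N. q powi (int N + j + m)) \<longlonglongrightarrow> 0"
    by simp
  then have "(\<lambda>N. lattice_kernel q m e (int N) j) \<longlonglongrightarrow>
      ((\<Sum>k\<le>e. (q powi (2 * j + m)) ^ k) - 0 * (\<Sum>k<e. (q powi (2 * j + m)) ^ k)) *
      (1 / (qpoch_inf q q)\<^sup>2)"
    unfolding lattice_kernel_def by (intro tendsto_intros bailey_kernel_LIMSEQ assms(2))
  then show ?thesis
    by simp
qed

lemma lattice_kernel_bounded:
  fixes q :: complex
  assumes "norm q < 1"
  obtains C where "C \<ge> 0"
    "\<And>e n j. norm (lattice_kernel q m e n j) \<le> C * (\<Sum>k\<le>e. norm (q powi (2 * j + m)) ^ k)"
proof -
  obtain C where C: "C > 0" "\<And>k. norm (rqfac q k) \<le> C"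
    using rqfac_bounded[OF assms] by blast
  have "norm (lattice_kernel q m e n j) \<le>
      2 * (C * C) * (\<Sum>k\<le>e. norm (q powi (2 * j + m)) ^ k)" for e n j
  proof (cases "n + j + m < 0")
    case True
    then show ?thesis
      using C(1) by (simp add: lattice_kernel_eq_0 sum_nonneg)
  next
    case False
    define y G where "y = q powi (2 * j + m)" and "G = (\<Sum>k\<le>e. norm y ^ k)"
    have "norm (\<Sum>k\<le>e. y ^ k) \<le> G"
      unfolding G_def by (rule order_trans[OF norm_sum]) (simp add: norm_power)
    moreover have "norm (\<Sum>k<e. y ^ k) \<le> G"
      unfolding G_def
      by (rule order_trans[OF norm_sum]) (auto simp: norm_power intro!: sum_mono2)
    moreover have "norm (q powi (n + j + m)) \<le> 1"
      using False assms by (simp add: norm_power power_le_one power_int_nonneg_exp)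
    ultimately have "norm ((\<Sum>k\<le>e. y ^ k) - q powi (n + j + m) * (\<Sum>k<e. y ^ k)) \<le> G + 1 * G"
      unfolding norm_mult[symmetric]
      by (intro order_trans[OF norm_triangle_ineq4] add_mono
          order_trans[OF norm_mult_ineq] mult_mono) auto
    moreover have "norm (bailey_kernel q m n j) \<le> C * C"
      unfolding bailey_kernel_def norm_mult using C by (intro mult_mono) auto
    ultimately have "norm (lattice_kernel q m e n j) \<le> (G + 1 * G) * (C * C)"
      unfolding lattice_kernel_def y_def[symmetric] norm_mult
      by (intro mult_mono) (auto simp: G_def sum_nonneg)
    then show ?thesis
      by (simp add: y_def G_def mult_ac)
  qed
  then show ?thesis
    using C(1) by (intro that[of "2 * (C * C)"]) auto
qed

lemma bailey_pair_LIMSEQ: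
  fixes q :: complex
  assumes "q \<noteq> 0" "norm q < 1" "bailey_pair q m e \<alpha> \<beta>"
    and summable: "(\<lambda>j. norm (\<alpha> j) * (\<Sum>k\<le>e. norm (q powi (2 * j + m)) ^ k)) summable_on UNIV"
  shows "(\<lambda>N. \<beta> (int N)) \<longlonglongrightarrow>
    (\<Sum>\<^sub>\<infinity>j. \<alpha> j * (\<Sum>k\<le>e. (q powi (2 * j + m)) ^ k)) / (qpoch_inf q q)\<^sup>2"
proof -
  define f where "f = (\<lambda>N j. \<alpha> j * lattice_kernel q m e (int N) j)"
  obtain C where C: "C \<ge> 0"
    "\<And>n j. norm (lattice_kernel q m e n j) \<le> C * (\<Sum>k\<le>e. norm (q powi (2 * j + m)) ^ k)"
    using lattice_kernel_bounded[OF assms(2)] by metis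
  have "(\<lambda>N. infsum (f N) UNIV) \<longlonglongrightarrow>
      (\<Sum>\<^sub>\<infinity>j. \<alpha> j * (\<Sum>k\<le>e. (q powi (2 * j + m)) ^ k) * (1 / (qpoch_inf q q)\<^sup>2))"
  proof (rule infsum_dominated_convergence)
    show "norm (f N j) \<le> C * (norm (\<alpha> j) * (\<Sum>k\<le>e. norm (q powi (2 * j + m)) ^ k))" for N j
      using mult_left_mono[OF C(2), of "norm (\<alpha> j)"] by (simp add: f_def norm_mult mult_ac)
    show "(\<lambda>j. C * (norm (\<alpha> j) * (\<Sum>k\<le>e. norm (q powi (2 * j + m)) ^ k))) summable_on UNIV"
      by (intro summable_on_cmult_right summable)
    show "(\<lambda>N. f N j) \<longlonglongrightarrow> \<alpha> j * (\<Sum>k\<le>e. (q powi (2 * j + m)) ^ k) * (1 / (qpoch_inf q q)\<^sup>2)" for j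
      unfolding f_def using tendsto_mult[OF tendsto_const lattice_kernel_LIMSEQ[OF assms(1,2)]]
      by simp
  qed
  moreover have "infsum (f N) UNIV = \<beta> (int N)" for N
  proof -
    have "infsum (f N) UNIV = infsum (f N) {-m-int N..int N}"
      by (rule infsum_cong_neutral) (auto simp: f_def lattice_kernel_eq_0)
    then show ?thesis
      using assms(3) by (simp add: f_def bailey_pair_def)
  qed
  ultimately show ?thesis
    unfolding infsum_cmult_left' by simp
qed

lemma norm_one_plus_power_int_ge:
  fixes q :: complex
  assumes "q \<noteq> 0" "norm q < 1"
  shows "1 - norm q \<le> norm (1 + q powi c)"
proof -
  have norm: "norm (q powi c) = norm q powi c"
    by (rule norm_power_int)
  consider (zero) "c = 0" | (positive) "c \<ge> 1" | (negative) "c \<le> -1"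
    by linarith
  then show ?thesis
  proof cases
    case zero
    then show ?thesis
      using assms by (simp add: order_trans[of _ 1])
  next
    case positive
    then have "norm q powi c \<le> norm q powi 1"
      using assms by (intro power_int_decreasing) auto
    then show ?thesis
      using norm norm_diff_ineq[of 1 "q powi c"] by simp
  next
    case negative
    then have "norm q powi (-1) \<le> norm q powi c"
      using assms by (intro power_int_decreasing) auto
    moreover have "2 - norm q \<le> norm q powi (-1)"
      using assms sum_squares_ge_zero[of "norm q - 1" 0]
      by (simp add: power_int_minus field_simps)
    ultimately show ?thesis
      using norm norm_diff_ineq[of "q powi c" 1] by (simp add: add.commute)
  qed
qed

lemma chain_numerator_eq_theta_term:
  fixes q :: complex
  assumes "q \<noteq> 0"
  shows "chain_numerator q m k e j * (q powi (2 * j + m)) ^ n =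
    q powi (m * int n) * theta_term (q ^ (2 * Suc k))
      (q powi (int k * m + int (Suc k) - int e + 2 * int n)) j"
proof -
  have "(q powi (2 * j + m)) ^ n = q powi ((2 * j + m) * int n)"
    by (simp only: power_int_mult power_int_of_nat)
  moreover have "int (Suc k) * j\<^sup>2 + (int k * m - int e) * j + (2 * j + m) * int n =
      m * int n + (int (Suc k) * (j\<^sup>2 - j) + (int k * m + int (Suc k) - int e + 2 * int n) * j)"
    by (simp add: algebra_simps)
  then have "q powi (int (Suc k) * j\<^sup>2 + (int k * m - int e) * j) * q powi ((2 * j + m) * int n) =
      q powi (m * int n) * (q powi (int (Suc k) * (j\<^sup>2 - j)) *
        (q powi (int k * m + int (Suc k) - int e + 2 * int n)) powi j)"
    using assms by (simp only: power_int_add[symmetric] power_int_mult[symmetric] simp_thms)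
  ultimately show ?thesis
    unfolding chain_numerator_def theta_term_def power_int_choose_two by (simp only: mult_ac)
qed

lemma chain_numerator_abs_summable:
  fixes q :: complex
  assumes "q \<noteq> 0" "norm q < 1"
  shows "(\<lambda>j. norm (chain_numerator q m k e j * (q powi (2 * j + m)) ^ n)) summable_on UNIV"
proof -
  have "norm (q ^ (2 * Suc k)) < 1"
    by (rule norm_power_less_1) (use assms(2) in auto)
  then show ?thesis
    unfolding chain_numerator_eq_theta_term[OF assms(1)] norm_mult
    using assms(1) by (intro summable_on_cmult_right theta_term_abs_summable) auto
qed

lemma summable_on_sum:
  fixes f :: "'b \<Rightarrow> 'a \<Rightarrow> 'c::topological_comm_monoid_add"
  assumes "\<And>k. k \<in> I \<Longrightarrow> f k summable_on A"
  shows "(\<lambda>x. \<Sum>k\<in>I. f k x) summable_on A"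
  using assms by (induction I rule: infinite_finite_induct) (auto intro!: summable_on_add)

lemma chain_alpha_summable:
  fixes q :: complex
  assumes "q \<noteq> 0" "norm q < 1"
  shows "(\<lambda>j. norm (chain_alpha q m k e j) *
      (\<Sum>l\<le>d. norm (q powi (2 * j + m)) ^ l)) summable_on UNIV"
proof (rule summable_on_comparison_test)
  show "(\<lambda>j. \<Sum>l\<le>d. norm (chain_numerator q m k e j * (q powi (2 * j + m)) ^ l) /
      (1 - norm q)) summable_on UNIV"
    unfolding divide_inverse
    by (intro summable_on_sum summable_on_cmult_left chain_numerator_abs_summable assms)
  show "norm (chain_alpha q m k e j) * (\<Sum>l\<le>d. norm (q powi (2 * j + m)) ^ l) \<le>
      (\<Sum>l\<le>d. norm (chain_numerator q m k e j * (q powi (2 * j + m)) ^ l) / (1 - norm q))" for j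
  proof -
    have "norm (chain_alpha q m k e j) \<le> norm (chain_numerator q m k e j) / (1 - norm q)"
      unfolding chain_alpha_def norm_divide
      using norm_one_plus_power_int_ge[OF assms] assms(2) by (intro frac_le) auto
    then have "norm (chain_alpha q m k e j) * (\<Sum>l\<le>d. norm (q powi (2 * j + m)) ^ l) \<le>
        norm (chain_numerator q m k e j) / (1 - norm q) * (\<Sum>l\<le>d. norm (q powi (2 * j + m)) ^ l)"
      by (rule mult_right_mono) (simp add: sum_nonneg)
    then show ?thesis
      by (simp add: sum_distrib_left norm_mult norm_power)
  qed
qed (simp add: sum_nonneg)

definition bilateral_sum :: "complex \<Rightarrow> int \<Rightarrow> nat \<Rightarrow> nat \<Rightarrow> complex" where
  "bilateral_sum q m k e = (\<Sum>\<^sub>\<infinity>j. chain_alpha q m k e j * (\<Sum>l\<le>e. (q powi (2 * j + m)) ^ l))"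

lemma chain_sum_LIMSEQ_bilateral_sum:
  assumes "q \<noteq> 0" "norm q < 1" "i < r"
  shows "(\<lambda>N. chain_sum q m r i 0 (int N)) \<longlonglongrightarrow> bilateral_sum q (int m) (r - 1) i / (qpoch_inf q q)\<^sup>2"
  using bailey_pair_LIMSEQ[OF assms(1,2) bailey_pair_chain_sum[OF assms(1-3), of 0]
      chain_alpha_summable[OF assms(1,2)]] assms(3) by (simp add: bilateral_sum_def)

lemma innermost_weight_eq_0: "0 < n \<or> m + 2 * n < 0 \<Longrightarrow> innermost_weight q m n = 0"
  by (auto simp: innermost_weight_def qbinom_def)

lemma innermost_weight_abs_summable: "(\<lambda>n. norm (innermost_weight q m n)) summable_on UNIV"
proof -
  have "(\<lambda>n. norm (innermost_weight q m n)) summable_on {- (m div 2)..0}"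
    by simp
  also have "?this \<longleftrightarrow> ?thesis"
    by (rule summable_on_cong_neutral) (auto intro!: innermost_weight_eq_0)
  finally show ?thesis .
qed

lemma norm_power_int_gaussian_summable:
  fixes q :: complex
  assumes "q \<noteq> 0" "norm q < 1"
  shows "(\<lambda>n. norm (q powi (n\<^sup>2 + b * n))) summable_on UNIV"
proof -
  have "norm (q powi (n\<^sup>2 + b * n)) =
      ((norm q)\<^sup>2) powi choose_two n * (norm q powi (b + 1)) powi n" for n
  proof -
    have "n\<^sup>2 + b * n = 2 * choose_two n + (b + 1) * n"
      unfolding two_times_choose_two by (simp add: algebra_simps)
    then show ?thesis
      unfolding norm_power_int using assms(1) power_int_mult[of "norm q" 2]
      by (simp add: power_int_add power_int_mult)
  qed
  then show ?thesis
    using summable_on_theta[of "(norm q)\<^sup>2" "norm q powi (b + 1)"] assms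
    by (simp add: power_less_one_iff)
qed

lemma chain_weight_abs_summable:
  assumes "q \<noteq> 0" "norm q < 1" "r \<ge> 1"
  shows "(\<lambda>s. norm (chain_weight q m r i 1 s)) summable_on index_tuples m r"
proof -
  obtain C\<^sub>1 where C\<^sub>1: "C\<^sub>1 > 0" "\<And>k. norm (rqfac q k) \<le> C\<^sub>1"
    using rqfac_bounded[OF assms(2)] by blast
  obtain C\<^sub>2 where C\<^sub>2: "C\<^sub>2 > 0" "\<And>k. norm (rqfac (q\<^sup>2) k) \<le> C\<^sub>2"
    using rqfac_bounded[OF norm_power_less_1[OF assms(2), of 2]] by auto
  define C where "C = max C\<^sub>1 C\<^sub>2"
  have link: "norm (link q r j d) \<le> C" for j d
    using C\<^sub>1(2)[of d] C\<^sub>2(2)[of d] by (auto simp: link_def C_def)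
  define f where "f = (\<lambda>j n. if j < r then q powi (n\<^sup>2 + (int m - of_bool (j \<le> i)) * n)
    else innermost_weight q (int m) n)"
  have interval: "{1..r} = insert r {1..<r}"
    using assms(3) by auto
  have "(\<lambda>n. norm (f j n)) summable_on UNIV" for j
    using norm_power_int_gaussian_summable[OF assms(1,2), of "int m - of_bool (j \<le> i)"]
      innermost_weight_abs_summable[of q "int m"]
    by (cases "j < r") (simp_all only: f_def if_True if_False)
  then have "(\<lambda>s. norm (\<Prod>j\<in>{1..r}. f j (s j))) summable_on ({1..r} \<rightarrow>\<^sub>E UNIV)"
    unfolding abs_summable_equivalent by (intro abs_summable_on_prod_PiE) auto
  then have "(\<lambda>s. norm (\<Prod>j\<in>{1..r}. f j (s j))) summable_on index_tuples m r"
    by (rule summable_on_subset_banach) (auto simp: index_tuples_def)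
  then have "(\<lambda>s. C ^ (r - 1) * norm (\<Prod>j\<in>{1..r}. f j (s j))) summable_on index_tuples m r"
    by (rule summable_on_cmult_right)
  then show ?thesis
  proof (rule summable_on_comparison_test)
    fix s
    have "chain_weight q m r i 1 s =
        (\<Prod>j=1..<r. link q r j (s j - s (Suc j))) * (\<Prod>j\<in>{1..r}. f j (s j))"
      unfolding interval chain_weight_def by (simp add: f_def prod.distrib mult_ac)
    moreover have "(\<Prod>j=1..<r. norm (link q r j (s j - s (Suc j)))) \<le> (\<Prod>j=1..<r. C)"
      using link by (intro prod_mono) auto
    ultimately show "norm (chain_weight q m r i 1 s) \<le> C ^ (r - 1) * norm (\<Prod>j\<in>{1..r}. f j (s j))"
      by (simp add: norm_mult prod_norm mult_right_mono)
  qed simp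
qed

lemma chain_sum_LIMSEQ_infsum:
  assumes "q \<noteq> 0" "norm q < 1" "r \<ge> 2"
  shows "(\<lambda>N. chain_sum q m r i 0 (int N)) \<longlonglongrightarrow>
    infsum (chain_weight q m r i 1) (index_tuples m r) / qpoch_inf q q"
proof -
  obtain C where C: "C > 0" "\<And>k. norm (rqfac q k) \<le> C"
    using rqfac_bounded[OF assms(2)] by blast
  define f where "f = (\<lambda>N s. rqfac q (int N - s 1) * chain_weight q m r i 1 s)"
  have "(\<lambda>N. infsum (f N) (index_tuples m r)) \<longlonglongrightarrow>
     (\<Sum>\<^sub>\<infinity>s\<in>index_tuples m r. 1 / qpoch_inf q q * chain_weight q m r i 1 s)"
  proof (rule infsum_dominated_convergence)
    show "(\<lambda>s. C * norm (chain_weight q m r i 1 s)) summable_on index_tuples m r"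
      using assms by (intro summable_on_cmult_right chain_weight_abs_summable) auto
    show "norm (f N s) \<le> C * norm (chain_weight q m r i 1 s)" for N s
      unfolding f_def norm_mult using C by (intro mult_right_mono) auto
    show "(\<lambda>N. f N s) \<longlonglongrightarrow> 1 / qpoch_inf q q * chain_weight q m r i 1 s" for s
      unfolding f_def using rqfac_LIMSEQ[OF assms(2), of "- s 1"]
      by (intro tendsto_mult tendsto_const) simp
  qed
  moreover have "infsum (f N) (index_tuples m r) = chain_sum q m r i 0 (int N)" for N
  proof -
    have "infsum (f N) (index_tuples m r) = infsum (f N) (chain_tuples m r 1 (int N))"
      by (rule infsum_cong_neutral)
         (auto simp: chain_tuples_eq_index_tuples[unfolded One_nat_def] f_def)
    also have "\<dots> = chain_sum q m r i 0 (int N)"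
      using assms(3) finite_chain_tuples[of 1 r m "int N"]
      by (simp add: chain_sum_def f_def link_def)
    finally show ?thesis .
  qed
  ultimately show ?thesis
    unfolding infsum_cmult_right' by simp
qed

section \<open>Symmetrization\<close>

definition theta_value :: "complex \<Rightarrow> int \<Rightarrow> nat \<Rightarrow> nat \<Rightarrow> nat \<Rightarrow> complex" where
  "theta_value q m k e n =
    q powi (m * int n) * theta_prod (q ^ (2 * Suc k))
      (q powi (int k * m + int (Suc k) - int e + 2 * int n))"

lemma chain_numerator_has_sum:
  assumes "q \<noteq> 0" "norm q < 1"
  shows "((\<lambda>j. chain_numerator q m k e j * (q powi (2 * j + m)) ^ n) has_sum
      theta_value q m k e n) UNIV"
  unfolding chain_numerator_eq_theta_term[OF assms(1)] theta_value_def
proof (intro has_sum_cmult_right jacobi_triple_product)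
  show "norm (q ^ (2 * Suc k)) < 1"
    by (rule norm_power_less_1) (use assms(2) in auto)
qed (use assms(1) in auto)

lemma has_sum_reflect_int:
  fixes f :: "int \<Rightarrow> 'a::{comm_monoid_add, t2_space}"
  shows "((\<lambda>j. f (c - j)) has_sum S) UNIV \<longleftrightarrow> (f has_sum S) UNIV"
  by (rule has_sum_reindex_bij_witness[of _ "\<lambda>j. c - j" "\<lambda>j. c - j"]) auto

lemma chain_numerator_reflect:
  assumes "q \<noteq> 0"
  shows "chain_numerator q (int m) k e (- int m - j) =
    (-1) ^ m * (q powi (2 * j + int m)) ^ (m + e) * chain_numerator q (int m) k e j"
proof -
  have "int (Suc k) * (- int m - j)\<^sup>2 + (int k * int m - int e) * (- int m - j) =
      (2 * j + int m) * int (m + e) + (int (Suc k) * j\<^sup>2 + (int k * int m - int e) * j)"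
    by (simp add: algebra_simps power2_eq_square)
  then have "q powi (int (Suc k) * (- int m - j)\<^sup>2 + (int k * int m - int e) * (- int m - j)) =
      (q powi (2 * j + int m)) ^ (m + e) * q powi (int (Suc k) * j\<^sup>2 + (int k * int m - int e) * j)"
    using assms by (simp only: power_int_add power_int_mult power_int_of_nat simp_thms)
  moreover have "(-1 :: 'a) powi (- int m - j) = (-1) ^ m * (-1) powi j"
    by (simp add: power_int_diff power_int_minus power_int_minus_left)
  ultimately show ?thesis
    unfolding chain_numerator_def by (simp only: mult_ac)
qed

lemma theta_value_reflect:
  assumes "q \<noteq> 0" "norm q < 1" "n \<le> m + e"
  shows "theta_value q (int m) k e n = (-1) ^ m * theta_value q (int m) k e (m + e - n)"
proof -
  let ?f = "\<lambda>n j. chain_numerator q (int m) k e j * (q powi (2 * j + int m)) ^ n"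
  have "?f n (- int m - j) = (-1) ^ m * ?f (m + e - n) j" for j
  proof -
    have "q powi (2 * (- int m - j) + int m) = inverse (q powi (2 * j + int m))"
      by (simp add: algebra_simps flip: power_int_minus)
    moreover have "q powi (2 * j + int m) \<noteq> 0"
      using assms(1) by simp
    ultimately show ?thesis
      using assms(3)
      by (simp add: chain_numerator_reflect[OF assms(1)] power_diff power_inverse divide_inverse)
  qed
  moreover have "((\<lambda>j. ?f n (- int m - j)) has_sum theta_value q (int m) k e n) UNIV"
    unfolding has_sum_reflect_int[of "?f n"] by (rule chain_numerator_has_sum[OF assms(1,2)])
  ultimately have "((\<lambda>j. (-1) ^ m * ?f (m + e - n) j) has_sum theta_value q (int m) k e n) UNIV"
    by simp
  then show ?thesis
    using has_sum_cmult_right[OF chain_numerator_has_sum[OF assms(1,2)]] by (rule has_sum_unique)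
qed

lemma sum_powers_reflect:
  fixes y :: "'a::field"
  assumes "y \<noteq> 0"
  shows "y ^ e * (\<Sum>k\<le>e. inverse y ^ k) = (\<Sum>k\<le>e. y ^ k)"
proof -
  have "y ^ e * (\<Sum>k\<le>e. inverse y ^ k) = (\<Sum>k\<le>e. y ^ (e - k))"
    unfolding sum_distrib_left using assms
    by (intro sum.cong) (auto simp: power_diff divide_inverse power_inverse)
  also have "\<dots> = (\<Sum>k\<le>e. y ^ k)"
    by (rule sum.nat_diff_reindex[of "\<lambda>k. y ^ k" "Suc e",
          unfolded lessThan_Suc_atMost diff_Suc_Suc])
  finally show ?thesis .
qed

text \<open>In the sum with the reflected term the denominators \<open>1 + y\<close> and \<open>1 + 1 / y\<close> cancel, since
  \<open>1 + y\<close> divides \<open>1 - (-y)\<^sup>m\<^sup>+\<^sup>1\<close>.\<close>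

lemma chain_alpha_symmetrized:
  fixes q :: "'a::field_char_0" and m k e :: nat and j :: int
  assumes "q \<noteq> 0" "not_root_of_unity q"
  defines "f \<equiv> \<lambda>j. chain_alpha q (int m) k e j * (\<Sum>l\<le>e. (q powi (2 * j + int m)) ^ l)"
  defines "y \<equiv> q powi (2 * j + int m)"
  shows "f j + f (- int m - j) =
      chain_numerator q (int m) k e j * (\<Sum>a\<le>e. y ^ a) * (\<Sum>l\<le>m. (- y) ^ l)"
proof -
  define N A where "N = chain_numerator q (int m) k e j" and "A = (\<Sum>l\<le>e. y ^ l)"
  have y: "y \<noteq> 0" "1 + y \<noteq> 0"
    unfolding y_def using assms(1) one_plus_power_int_nonzero[OF assms(2)] by auto
  have "q powi (2 * (- int m - j) + int m) = inverse y"
    by (simp add: y_def algebra_simps flip: power_int_minus)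
  then have "f (- int m - j) =
      (-1) ^ m * y ^ m * N * (y ^ e * (\<Sum>l\<le>e. inverse y ^ l)) / (1 + inverse y)"
    unfolding f_def chain_alpha_def chain_numerator_reflect[OF assms(1)] N_def y_def
    by (simp add: power_add)
  also have "\<dots> = N * A * (1 - (1 - (-1) ^ m * y ^ Suc m)) / (1 + y)"
    unfolding sum_powers_reflect[OF y(1)] A_def[symmetric] using y by (simp add: field_simps)
  finally have "f j + f (- int m - j) = N * A * ((1 - (- y) ^ Suc m) / (1 + y))"
    unfolding f_def chain_alpha_def N_def[symmetric] y_def[symmetric] A_def[symmetric]
    using y(2) by (simp add: power_minus[of y] field_simps)
  also have "(1 - (- y) ^ Suc m) / (1 + y) = (\<Sum>l\<le>m. (- y) ^ l)"
    using one_diff_power_eq[of "- y" "Suc m"] y(2) by (simp add: lessThan_Suc_atMost field_simps)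
  finally show ?thesis
    unfolding N_def A_def .
qed

lemma has_sum_sum:
  fixes f :: "'b \<Rightarrow> 'a \<Rightarrow> 'c::topological_comm_monoid_add"
  assumes "\<And>k. k \<in> I \<Longrightarrow> (f k has_sum s k) A"
  shows "((\<lambda>x. \<Sum>k\<in>I. f k x) has_sum (\<Sum>k\<in>I. s k)) A"
  using assms by (induction I rule: infinite_finite_induct) (auto intro!: has_sum_add)

lemma two_bilateral_sum:
  assumes "q \<noteq> 0" "norm q < 1"
  shows "2 * bilateral_sum q (int m) k e =
      (\<Sum>a\<le>e. \<Sum>l\<le>m. (-1) ^ l * theta_value q (int m) k e (a + l))"
proof (rule has_sum_unique)
  define f where "f = (\<lambda>j. chain_alpha q (int m) k e j * (\<Sum>l\<le>e. (q powi (2 * j + int m)) ^ l))"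
  have "(\<lambda>j. norm (f j)) summable_on UNIV"
  proof (rule Infinite_Sum.abs_summable_on_comparison_test'[OF chain_alpha_summable[OF assms]])
    show "norm (f j) \<le> norm (chain_alpha q (int m) k e j) *
        (\<Sum>l\<le>e. norm (q powi (2 * j + int m)) ^ l)" for j
      unfolding f_def norm_mult norm_power[symmetric] by (intro mult_left_mono norm_sum) auto
  qed
  then have f: "(f has_sum bilateral_sum q (int m) k e) UNIV"
    unfolding bilateral_sum_def f_def[symmetric]
    by (intro has_sum_infsum) (rule abs_summable_summable)
  show "((\<lambda>j. f j + f (- int m - j)) has_sum 2 * bilateral_sum q (int m) k e) UNIV"
    unfolding mult_2 using f by (intro has_sum_add) (simp_all add: has_sum_reflect_int)
  have "f j + f (- int m - j) =
      (\<Sum>a\<le>e. \<Sum>l\<le>m. (-1) ^ l *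
        (chain_numerator q (int m) k e j * (q powi (2 * j + int m)) ^ (a + l)))" for j
    unfolding f_def mult.assoc sum_product
      chain_alpha_symmetrized[OF assms(1) not_root_of_unity_if_norm_less_1[OF assms(2)]]
      power_minus[of "q powi (2 * j + int m)"] unfolding sum_distrib_left power_add
    by (simp only: mult_ac)
  then show "((\<lambda>j. f j + f (- int m - j)) has_sum
      (\<Sum>a\<le>e. \<Sum>l\<le>m. (-1) ^ l * theta_value q (int m) k e (a + l))) UNIV"
    by (simp only:) (intro has_sum_sum has_sum_cmult_right chain_numerator_has_sum assms)
qed

lemma sum_alternating_odd:
  fixes T :: "nat \<Rightarrow> 'a::comm_ring_1"
  shows "(\<Sum>l\<le>2 * p + 1. (-1) ^ l * T l) = (\<Sum>l\<le>p. T (2 * l) - T (2 * l + 1))"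
  by (induction p) (simp_all add: algebra_simps)

lemma bilateral_sum_odd:
  assumes "q \<noteq> 0" "norm q < 1" "odd m"
  shows "bilateral_sum q (int m) k e = (\<Sum>l\<le>m div 2. theta_value q (int m) k e (2 * l))"
proof -
  define T p where "T = theta_value q (int m) k e" and "p = m div 2"
  have m: "m = 2 * p + 1"
    using assms(3) by (simp add: p_def)
  have "(\<Sum>l\<le>m. (-1) ^ l * T (a + l)) = (\<Sum>l\<le>p. T (a + 2 * l) - T (a + (2 * l + 1)))" for a
    unfolding m by (rule sum_alternating_odd)
  then have "2 * bilateral_sum q (int m) k e = (\<Sum>a\<le>e. \<Sum>l\<le>p. T (a + 2 * l) - T (a + (2 * l + 1)))"
    unfolding two_bilateral_sum[OF assms(1,2)] T_def by simp
  also have "\<dots> = (\<Sum>l\<le>p. \<Sum>a\<le>e. T (a + 2 * l) - T (Suc a + 2 * l))"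
    by (subst sum.swap) (simp add: algebra_simps)
  also have "\<dots> = (\<Sum>l\<le>p. T (2 * l)) - (\<Sum>l\<le>p. T (Suc e + 2 * l))"
    using sum_telescope[of "\<lambda>a. T (a + 2 * _)" e] by (simp add: sum_subtractf[symmetric])
  also have "(\<Sum>l\<le>p. T (Suc e + 2 * l)) = (\<Sum>l\<le>p. - T (2 * (p - l)))"
  proof (rule sum.cong[OF refl])
    fix l assume "l \<in> {..p}"
    then have "m + e - (Suc e + 2 * l) = 2 * (p - l)" "Suc e + 2 * l \<le> m + e"
      by (auto simp: m)
    then show "T (Suc e + 2 * l) = - T (2 * (p - l))"
      using theta_value_reflect[OF assms(1,2), of "Suc e + 2 * l" m e k] assms(3)
      by (simp add: T_def)
  qed
  also have "\<dots> = - (\<Sum>l\<le>p. T (2 * l))"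
    using sum.nat_diff_reindex[of "\<lambda>l. T (2 * l)" "Suc p"]
    by (simp add: sum_negf lessThan_Suc_atMost)
  finally show ?thesis
    by (simp add: T_def p_def)
qed

lemma a_even_eq:
  assumes "q \<noteq> 0" "norm q < 1" "even m"
  shows "a_even q (Suc k) i (m div 2) = bilateral_sum q (int m) k i / qpoch_inf q q"
proof -
  define p where "p = m div 2"
  have m: "m = 2 * p"
    using assms(3) by (simp add: p_def)
  have summand: "q ^ (2*p*a + 2*p*l) * qpoch_infs
       [q ^ (2*Suc k),
        q powi (2 * int p * (int (Suc k) - 1) + int (Suc k) - int i + 2 * int a + 2 * int l),
        q powi (int (Suc k) + int i - 2 * int p * (int (Suc k) - 1) - 2 * int a - 2 * int l)]
       (q ^ (2*Suc k)) = theta_value q (int m) k i (a + l)" for a l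
  proof -
    have exponent: "2 * int p * (int (Suc k) - 1) + int (Suc k) - int i + 2 * int a + 2 * int l =
        int k * int m + int (Suc k) - int i + 2 * int (a + l)"
      and exponent': "int (Suc k) + int i - 2 * int p * (int (Suc k) - 1) - 2 * int a - 2 * int l =
        int (2 * Suc k) - (int k * int m + int (Suc k) - int i + 2 * int (a + l))"
      by (simp_all add: m algebra_simps)
    have "q ^ (2*p*a + 2*p*l) = q powi (int m * int (a + l))"
      by (simp only: m distrib_left of_nat_mult[symmetric] power_int_of_nat)
    then show ?thesis
      unfolding exponent exponent' theta_value_def theta_prod_power_int[OF assms(1)] by (simp only:)
  qed
  have "a_even q (Suc k) i p =
      (\<Sum>a\<le>i. \<Sum>l\<le>m. (-1) ^ l * theta_value q (int m) k i (a + l)) / (2 * qpoch_inf q q)"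
    unfolding a_even_def times_divide_eq_right mult.assoc[of "(-1) ^ _"] summand
    by (simp add: m sum_divide_distrib atLeast0AtMost)
  then show ?thesis
    unfolding two_bilateral_sum[OF assms(1,2), symmetric] p_def by simp
qed

lemma theta_value_odd:
  assumes "q \<noteq> 0" "norm q < 1"
  shows "theta_value q (int (2 * p + 1)) k e (2 * l) =
    (-1) ^ p * q powi ((2 - int (Suc k)) * (int p)\<^sup>2 + (1 + int e - int (Suc k)) * int p) *
    q ^ (2 * l) *
    theta_prod (q ^ (2 * Suc k)) (q powi (2 * int (Suc k) - 2 * int p - 1 - int e + 4 * int l))"
proof -
  define a where "a = int k * int (2 * p + 1) + int (Suc k) - int e + 2 * int (2 * l)"
  have shift: "a + int (2 * Suc k) * (- int p) =
      2 * int (Suc k) - 2 * int p - 1 - int e + 4 * int l"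
    by (simp add: a_def algebra_simps)
  have "int (2 * p + 1) * int (2 * l) + (int (Suc k) * ((- int p)\<^sup>2 - (- int p)) + a * (- int p)) =
      (2 - int (Suc k)) * (int p)\<^sup>2 + (1 + int e - int (Suc k)) * int p + int (2 * l)"
    by (simp add: a_def algebra_simps power2_eq_square)
  then have powers: "q powi (int (2 * p + 1) * int (2 * l)) *
      q powi (int (Suc k) * ((- int p)\<^sup>2 - (- int p)) + a * (- int p)) =
      q powi ((2 - int (Suc k)) * (int p)\<^sup>2 + (1 + int e - int (Suc k)) * int p) * q ^ (2 * l)"
    using assms(1) by (metis power_int_add power_int_of_nat)
  have "theta_value q (int (2 * p + 1)) k e (2 * l) = (-1) ^ p *
      (q powi (int (2 * p + 1) * int (2 * l)) *
       q powi (int (Suc k) * ((- int p)\<^sup>2 - (- int p)) + a * (- int p))) *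
      theta_prod (q ^ (2 * Suc k)) (q powi (a + int (2 * Suc k) * (- int p)))"
    unfolding theta_value_def a_def[symmetric]
      theta_prod_power_int_quasiperiodic[OF assms zero_less_Suc, of k a "- int p"]
    by (simp only: power_int_minus_one_minus power_int_of_nat mult_ac)
  then show ?thesis
    unfolding powers shift by (simp only: mult.assoc)
qed

lemma a_odd_eq:
  assumes "q \<noteq> 0" "norm q < 1" "odd m"
  shows "a_odd q (Suc k) i (m div 2) = bilateral_sum q (int m) k i / qpoch_inf q q"
proof -
  define p where "p = m div 2"
  have m: "m = 2 * p + 1"
    using assms(3) by (simp add: p_def)
  have "int i + 2 * int p + 1 - 4 * int l =
      int (2 * Suc k) - (2 * int (Suc k) - 2 * int p - 1 - int i + 4 * int l)" for l
    by simp
  then show ?thesis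
    unfolding bilateral_sum_odd[OF assms] p_def[symmetric]
    unfolding m theta_value_odd[OF assms(1,2)] theta_prod_power_int[OF assms(1)] a_odd_def
    by (simp only: sum_distrib_left sum_divide_distrib atLeast0AtMost mult.assoc
        times_divide_eq_right)
qed

lemma a_seq_eq:
  assumes "q \<noteq> 0" "norm q < 1" "r > 0"
  shows "a_seq q r i m = bilateral_sum q (int m) (r - 1) i / qpoch_inf q q"
  using a_even_eq[OF assms(1,2), of m "r - 1" i] a_odd_eq[OF assms(1,2), of m "r - 1" i] assms(3)
  by (simp add: a_seq_def)

theorem theorem2p6:
  fixes q :: complex and m r i :: nat
  assumes "q \<noteq> 0" and "norm q < 1"
    and "r \<ge> 2" and "i \<le> r - 1"
  shows
    "((\<lambda>s. q powi ((\<Sum>j=1..r. (s j)\<^sup>2) + int m * (\<Sum>j=1..r-1. s j) - (\<Sum>j=1..i. s j))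
             * qpoch (- q) q (int m + 2 * s r - 1)
             / ((\<Prod>j=1..r-2. qpoch q q (s j - s (Suc j)))
                * qpoch (q\<^sup>2) (q\<^sup>2) (s (r - 1) - s r))
             * (-1) powi (s r)
             * qbinom (q\<^sup>2) (int m + s r) (int m + 2 * s r))
       has_sum a_seq q r i m) (index_tuples m r)"
proof -
  have "infsum (chain_weight q m r i 1) (index_tuples m r) / qpoch_inf q q =
      bilateral_sum q (int m) (r - 1) i / (qpoch_inf q q)\<^sup>2"
  proof (rule LIMSEQ_unique)
    show "(\<lambda>N. chain_sum q m r i 0 (int N)) \<longlonglongrightarrow>
        infsum (chain_weight q m r i 1) (index_tuples m r) / qpoch_inf q q"
      by (rule chain_sum_LIMSEQ_infsum[OF assms(1-3)])
    show "(\<lambda>N. chain_sum q m r i 0 (int N)) \<longlonglongrightarrow> bilateral_sum q (int m) (r - 1) i / (qpoch_inf q q)\<^sup>2"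
      using assms by (intro chain_sum_LIMSEQ_bilateral_sum) auto
  qed
  then have "infsum (chain_weight q m r i 1) (index_tuples m r) =
      bilateral_sum q (int m) (r - 1) i / qpoch_inf q q"
    using qpoch_inf_self_nonzero[OF assms(2)] by (simp add: field_simps power2_eq_square)
  also have "\<dots> = a_seq q r i m"
    using assms(3) by (intro a_seq_eq[OF assms(1,2), symmetric]) auto
  finally have "infsum (chain_weight q m r i 1) (index_tuples m r) = a_seq q r i m" .
  moreover have "chain_weight q m r i 1 summable_on index_tuples m r"
    using assms by (intro abs_summable_summable[OF chain_weight_abs_summable]) auto
  ultimately show ?thesis
    by (subst has_sum_cong[OF summand_eq_chain_weight[OF assms]]) (simp_all add: has_sum_iff)
qed

end
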